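(* Let $n\ge 1$ and let $(\alpha_{2i})_{1\le i\le n}$ with $\alpha_{2i}\in\{0,1\}^{i-1}$ be an arbitrary parameter sequence. Then the inductive construction described in the context can be carried out up to and including the definition of $\mathcal{C}_{2n+1}$. For every $k=n,n+1,\ldots,2n-1$, the family $\mathcal{P}_{2n}(k,k+1)$ consists of pairwise disjoint oriented paths in $Q_{2n}(k,k+1)$ that start and end at a vertex of $B_{2n}(k)$, and: (i) The paths in $\mathcal{P}_{2n}(n,n+1)$ visit all vertices in the sets $B_{2n}(n+1)$ and $B_{2n}(n)$. (ii) For $k=n+1,\ldots,2n-1$, the paths in $\mathcal{P}_{2n}(k,k+1)$ visit all vertices in the set $B_{2n}(k+1)$, and the only vertices not visited in the set $B_{2n}(k)$ are exactly the elements of $S(\mathcal{P}_{2n}(k-1,k))$. Moreover, $\mathcal{C}_{2n+1}$ is a 2-factor of $Q_{2n+1}(n,n+1)$, with the additional property that on every cycle of $\mathcal{C}_{2n+1}$ all edges of the form $(F(P),S(P))\circ(0)$, $P\in\mathcal{P}_{2n}(n,n+1)$, are oriented the same way (i.e. for one of the two directions of traversal of the cycle, each such edge on the cycle is traversed from $F(P)\circ(0)$ to $S(P)\circ(0)$).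
   Context: Bitstrings and layers. $B_n=\{0,1\}^n$, and $B_n(k)\subseteq B_n$ is the set of bitstrings with exactly $k$ entries equal to 1. For $0\le k\le n-1$, $Q_n(k,k+1)$ is the graph with vertex set $B_n(k)\cup B_n(k+1)$ in which two vertices are adjacent iff they differ in exactly one bit. $x\circ y$ denotes concatenation of bitstrings; for a graph, path, set of bitstrings, or family of graphs/paths $X$, $X\circ y$ is obtained by appending $y$ to every bitstring (vertex) involved. $\overline{x}$ is the bitwise complement of $x$, and $\mathrm{rev}(x)$ is the reversed bitstring. A 2-factor of a graph is a 2-regular spanning subgraph. For an oriented path $P=(v_1,\ldots,v_l)$ let $F(P)=v_1$, $S(P)=v_2$, $L(P)=v_l$; for a family $\mathcal{P}$ of oriented paths, $F(\mathcal{P})=\{F(P)\mid P\in\mathcal{P}\}$, and similarly $S(\mathcal{P})$, $L(\mathcal{P})$. Maps $f_\alpha$. For $\alpha\in\{0,1\}^{n-1}$, $\pi_\alpha:B_{2n}\to B_{2n}$ swaps the bits at positions $2i$ and $2i+1$ for exactly those $i\in\{1,\ldots,n-1\}$ with $\alpha(i)=1$, leaving everything else unchanged; $f_\alpha(x):=\overline{\mathrm{rev}(\pi_\alpha(x))}$. It is applied to paths vertex by vertex and is an isomorphism from $Q_{2n}(n,n+1)$ to $Q_{2n}(n-1,n)$. Construction. Given parameters $\alpha_{2i}\in\{0,1\}^{i-1}$, define families of oriented paths $\mathcal{P}_{2n}(k,k+1)$ in $Q_{2n}(k,k+1)$, $k=n,\ldots,2n-1$ (depending on $\alpha_2,\ldots,\alpha_{2n-2}$),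 and graphs $\mathcal{C}_{2n+1}$ (depending on $\alpha_2,\ldots,\alpha_{2n}$). Base: $\mathcal{P}_2(1,2):=\{((1,0),(1,1),(0,1))\}$. Graph $\mathcal{C}_{2n+1}$: let $M_{2n+1}^{FL}$ be the set of edges $\{v\circ(0),v\circ(1)\}$ with $v\in F(\mathcal{P}_{2n}(n,n+1))\cup L(\mathcal{P}_{2n}(n,n+1))$, and let $$\mathcal{C}_{2n+1}:=\mathcal{P}_{2n}(n,n+1)\circ(0)\;\cup\; f_{\alpha_{2n}}(\mathcal{P}_{2n}(n,n+1))\circ(1)\;\cup\; M_{2n+1}^{FL}.$$ Step $n\to n+1$: with the conventions $\mathcal{P}_{2n}(2n,2n+1):=\mathcal{P}_{2n}(2n+1,2n+2):=\emptyset$, for $k=n+2,\ldots,2n+1$ let $$\mathcal{P}_{2n+2}(k,k+1):=\mathcal{P}_{2n}(k,k+1)\circ(0,0)\cup\mathcal{P}_{2n}(k-1,k)\circ(1,0)\cup\mathcal{P}_{2n}(k-1,k)\circ(0,1)\cup\mathcal{P}_{2n}(k-2,k-1)\circ(1,1).$$ Let $\mathcal{C}_{2n+1}^-$ be obtained from $\mathcal{C}_{2n+1}$ by deleting every edge $(F(P),S(P))\circ(0)$, $P\in\mathcal{P}_{2n}(n,n+1)$; let $M_{2n+2}^S$ be the set of edges $\{s\circ(0,0),s\circ(0,1)\}$ with $s\in S(\mathcal{P}_{2n}(n,n+1))$. Let $\mathcal{P}'_{2n+2}$ be the set of connected components of the graph $M_{2n+2}^S\cup\mathcal{C}_{2n+1}^-\circ(1)$,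 each regarded as an oriented path whose first edge is its edge from $M_{2n+2}^S$ (directed from $s\circ(0,0)$ to $s\circ(0,1)$). (That these components are indeed such paths is part of what it means that the construction can be carried out.) Finally $$\mathcal{P}_{2n+2}(n+1,n+2):=\mathcal{P}_{2n}(n+1,n+2)\circ(0,0)\cup\mathcal{P}_{2n}(n,n+1)\circ(1,0)\cup\mathcal{P}'_{2n+2}.$$ *)

theory Defs
  imports Main
begin

section \<open>Undirected graphs\<close>

record 'v graph =
  verts :: "'v set"
  edges :: "'v set set"

definition graph_union :: "'v graph \<Rightarrow> 'v graph \<Rightarrow> 'v graph" (infixl "\<squnion>" 65) where
  "G \<squnion> H = \<lparr>verts = verts G \<union> verts H, edges = edges G \<union> edges H\<rparr>"

definition delete_edges :: "'v graph \<Rightarrow> 'v set set \<Rightarrow> 'v graph" where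
  "delete_edges G D = \<lparr>verts = verts G, edges = edges G - D\<rparr>"

definition map_graph :: "('v \<Rightarrow> 'w) \<Rightarrow> 'v graph \<Rightarrow> 'w graph" where
  "map_graph f G = \<lparr>verts = f ` verts G, edges = (\<lambda>e. f ` e) ` edges G\<rparr>"

definition graph_of_edges :: "'v set set \<Rightarrow> 'v graph" where
  "graph_of_edges M = \<lparr>verts = \<Union>M, edges = M\<rparr>"

definition subgraph :: "'v graph \<Rightarrow> 'v graph \<Rightarrow> bool" where
  "subgraph H G \<longleftrightarrow> verts H \<subseteq> verts G \<and> edges H \<subseteq> edges G"

definition degree :: "'v graph \<Rightarrow> 'v \<Rightarrow> nat" where
  "degree G v = card {e \<in> edges G. v \<in> e}"

definition two_factor :: "'v graph \<Rightarrow> 'v graph \<Rightarrow> bool" where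
  "two_factor C G \<longleftrightarrow> subgraph C G \<and> verts C = verts G \<and> (\<forall>v\<in>verts C. degree C v = 2)"

definition adjacency :: "'v graph \<Rightarrow> ('v \<times> 'v) set" where
  "adjacency G = {(u, v). {u, v} \<in> edges G}"

definition component_of :: "'v graph \<Rightarrow> 'v \<Rightarrow> 'v graph" where
  "component_of G v =
    (let W = {w. (v, w) \<in> (adjacency G)\<^sup>*} in \<lparr>verts = W, edges = {e \<in> edges G. e \<subseteq> W}\<rparr>)"

definition components :: "'v graph \<Rightarrow> 'v graph set" where
  "components G = component_of G ` verts G"


section \<open>Oriented paths and cycles\<close>

text \<open>An oriented path is the list of its vertices, in order.\<close>

type_synonym 'v opath = "'v list"

definition arcs_path :: "'v opath \<Rightarrow> ('v \<times> 'v) set" where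
  "arcs_path p = {(p ! i, p ! Suc i) | i. Suc i < length p}"

definition path_graph :: "'v opath \<Rightarrow> 'v graph" where
  "path_graph p = \<lparr>verts = set p, edges = {{u, v} | u v. (u, v) \<in> arcs_path p}\<rparr>"

text \<open>At least two vertices are required, so that the second vertex of an oriented path exists.\<close>

definition is_opath :: "'v opath \<Rightarrow> bool" where
  "is_opath p \<longleftrightarrow> distinct p \<and> 2 \<le> length p"

definition opath_in :: "'v graph \<Rightarrow> 'v opath \<Rightarrow> bool" where
  "opath_in G p \<longleftrightarrow> is_opath p \<and> subgraph (path_graph p) G"

definition first_v :: "'v opath \<Rightarrow> 'v" where
  "first_v p = hd p"

definition second_v :: "'v opath \<Rightarrow> 'v" where
  "second_v p = p ! 1"

definition last_v :: "'v opath \<Rightarrow> 'v" where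
  "last_v p = last p"

definition visited :: "'v opath set \<Rightarrow> 'v set" where
  "visited \<P> = (\<Union>p\<in>\<P>. set p)"

definition family_graph :: "'v opath set \<Rightarrow> 'v graph" where
  "family_graph \<P> = \<lparr>verts = visited \<P>, edges = (\<Union>p\<in>\<P>. edges (path_graph p))\<rparr>"

text \<open>A cycle is a list of its vertices in the order of one traversal; the reversed list is the
  traversal of the same cycle in the opposite direction.\<close>

definition arcs_cycle :: "'v list \<Rightarrow> ('v \<times> 'v) set" where
  "arcs_cycle c = {(c ! i, c ! (Suc i mod length c)) | i. i < length c}"

definition cycle_edges :: "'v list \<Rightarrow> 'v set set" where
  "cycle_edges c = {{u, v} | u v. (u, v) \<in> arcs_cycle c}"

definition cycle_in :: "'v graph \<Rightarrow> 'v list \<Rightarrow> bool" where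
  "cycle_in G c \<longleftrightarrow>
    distinct c \<and> 3 \<le> length c \<and> set c \<subseteq> verts G \<and> cycle_edges c \<subseteq> edges G"


section \<open>Bitstrings and layers of the cube\<close>

text \<open>The bits 1 and 0 are \<open>True\<close> and \<open>False\<close>.\<close>

type_synonym bits = "bool list"

definition layer :: "nat \<Rightarrow> nat \<Rightarrow> bits set" where
  "layer n k = {x. length x = n \<and> count_list x True = k}"

text \<open>\<open>cube_layers n k\<close> is the graph \<open>Q\<^sub>n(k, k + 1)\<close>.\<close>

definition cube_layers :: "nat \<Rightarrow> nat \<Rightarrow> bits graph" where
  "cube_layers n k =
    (let V = layer n k \<union> layer n (k + 1) in
      \<lparr>verts = V,
       edges = {{x, y} | x y. x \<in> V \<and> y \<in> V \<and> card {i. i < n \<and> x ! i \<noteq> y ! i} = 1}\<rparr>)"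

definition append_family :: "bits opath set \<Rightarrow> bits \<Rightarrow> bits opath set" where
  "append_family \<P> y = map (\<lambda>x. x @ y) ` \<P>"

definition append_graph :: "bits graph \<Rightarrow> bits \<Rightarrow> bits graph" where
  "append_graph G y = map_graph (\<lambda>x. x @ y) G"


section \<open>The maps \<open>f\<^sub>\<alpha>\<close>\<close>

text \<open>Positions in bitstrings are counted from 1.\<close>

definition bit_at :: "bits \<Rightarrow> nat \<Rightarrow> bool" where
  "bit_at x i = x ! (i - 1)"

definition swap_position :: "bits \<Rightarrow> nat \<Rightarrow> nat" where
  "swap_position a j =
    (let i = j div 2 in
      if i \<in> {1..length a} \<and> bit_at a i then (if even j then j + 1 else j - 1) else j)"

definition pi_map :: "bits \<Rightarrow> bits \<Rightarrow> bits" where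
  "pi_map a x = map (\<lambda>j. bit_at x (swap_position a j)) [1..<Suc (length x)]"

definition f_map :: "bits \<Rightarrow> bits \<Rightarrow> bits" where
  "f_map a x = map Not (rev (pi_map a x))"


section \<open>The construction\<close>

text \<open>In this section \<open>\<P>\<close> is the family \<open>\<P>\<^sub>2\<^sub>n(n, n + 1)\<close> and \<open>a\<close> is \<open>\<alpha>\<^sub>2\<^sub>n\<close>.\<close>

definition M_FL :: "bits opath set \<Rightarrow> bits set set" where
  "M_FL \<P> = {{v @ [False], v @ [True]} | v. v \<in> first_v ` \<P> \<union> last_v ` \<P>}"

definition C_graph :: "bits \<Rightarrow> bits opath set \<Rightarrow> bits graph" where
  "C_graph a \<P> =
    family_graph (append_family \<P> [False])
    \<squnion> family_graph (append_family (map (f_map a) ` \<P>) [True])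
    \<squnion> graph_of_edges (M_FL \<P>)"

definition C_minus :: "bits \<Rightarrow> bits opath set \<Rightarrow> bits graph" where
  "C_minus a \<P> =
    delete_edges (C_graph a \<P>) {{first_v p @ [False], second_v p @ [False]} | p. p \<in> \<P>}"

definition M_S :: "bits opath set \<Rightarrow> bits set set" where
  "M_S \<P> = {{s @ [False, False], s @ [False, True]} | s. s \<in> second_v ` \<P>}"

definition joined_graph :: "bits \<Rightarrow> bits opath set \<Rightarrow> bits graph" where
  "joined_graph a \<P> = graph_of_edges (M_S \<P>) \<squnion> append_graph (C_minus a \<P>) [True]"

text \<open>\<open>p\<close> is the component \<open>H\<close>, regarded as an oriented path whose first edge is the only edge
  of \<open>H\<close> from \<open>M_S \<P>\<close>.\<close>

definition orients :: "bits opath set \<Rightarrow> bits graph \<Rightarrow> bits opath \<Rightarrow> bool" where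
  "orients \<P> H p \<longleftrightarrow>
    is_opath p \<and> path_graph p = H \<and>
    edges H \<inter> M_S \<P> = {{first_v p, second_v p}} \<and>
    (\<exists>s\<in>second_v ` \<P>. first_v p = s @ [False, False] \<and> second_v p = s @ [False, True])"

definition P_prime :: "bits \<Rightarrow> bits opath set \<Rightarrow> bits opath set" where
  "P_prime a \<P> = {p. \<exists>H\<in>components (joined_graph a \<P>). orients \<P> H p}"

definition step_possible :: "bits \<Rightarrow> bits opath set \<Rightarrow> bool" where
  "step_possible a \<P> \<longleftrightarrow>
    (\<forall>p\<in>\<P>. is_opath p) \<and> (\<forall>H\<in>components (joined_graph a \<P>). \<exists>!p. orients \<P> H p)"

text \<open>\<open>P_family \<alpha> n k\<close> is \<open>\<P>\<^sub>2\<^sub>n(k, k + 1)\<close>, and \<open>\<alpha> (2 * i)\<close> is \<open>\<alpha>\<^sub>2\<^sub>i\<close>. The family is empty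
  whenever \<open>n = 0\<close> or \<open>k\<close> is not in \<open>{n..2 * n - 1}\<close>; this includes the conventions for
  \<open>k = 2 * n\<close> and \<open>k = 2 * n + 1\<close>.\<close>

primrec P_family :: "(nat \<Rightarrow> bits) \<Rightarrow> nat \<Rightarrow> nat \<Rightarrow> bits opath set" where
  "P_family \<alpha> 0 = (\<lambda>k. {})"
| "P_family \<alpha> (Suc n) =
    (\<lambda>k.
      if n = 0 then
        (if k = 1 then {[[True, False], [True, True], [False, True]]} else {})
      else if k = n + 1 then
        append_family (P_family \<alpha> n (n + 1)) [False, False]
        \<union> append_family (P_family \<alpha> n n) [True, False]
        \<union> P_prime (\<alpha> (2 * n)) (P_family \<alpha> n n)
      else if n + 2 \<le> k \<and> k \<le> 2 * n + 1 then
        append_family (P_family \<alpha> n k) [False, False]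
        \<union> append_family (P_family \<alpha> n (k - 1)) [True, False]
        \<union> append_family (P_family \<alpha> n (k - 1)) [False, True]
        \<union> append_family (P_family \<alpha> n (k - 2)) [True, True]
      else {})"

text \<open>\<open>C_cycles \<alpha> n\<close> is \<open>\<C>\<^sub>2\<^sub>n\<^sub>+\<^sub>1\<close>.\<close>

definition C_cycles :: "(nat \<Rightarrow> bits) \<Rightarrow> nat \<Rightarrow> bits graph" where
  "C_cycles \<alpha> n = C_graph (\<alpha> (2 * n)) (P_family \<alpha> n n)"

text \<open>The construction can be carried out up to and including \<open>\<C>\<^sub>2\<^sub>n\<^sub>+\<^sub>1\<close>: every step from \<open>m\<close> to
  \<open>m + 1\<close> on the way is possible.\<close>

definition construction_possible :: "(nat \<Rightarrow> bits) \<Rightarrow> nat \<Rightarrow> bool" where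
  "construction_possible \<alpha> n \<longleftrightarrow>
    (\<forall>m\<in>{1..<n}. step_possible (\<alpha> (2 * m)) (P_family \<alpha> m m))"

text \<open>One of the two directions of traversal of the cycle \<open>c\<close> runs through all edges on \<open>c\<close> of
  the form \<open>(F(P), S(P)) \<circ> (0)\<close> from \<open>F(P) \<circ> (0)\<close> to \<open>S(P) \<circ> (0)\<close>.\<close>

definition same_orientation :: "bits opath set \<Rightarrow> bits list \<Rightarrow> bool" where
  "same_orientation \<P> c \<longleftrightarrow>
    (\<exists>d\<in>{c, rev c}. \<forall>p\<in>\<P>.
      {first_v p @ [False], second_v p @ [False]} \<in> cycle_edges c \<longrightarrow>
      (first_v p @ [False], second_v p @ [False]) \<in> arcs_cycle d)"

end

(* Call a bitstring a lattice path with steps +1 (bit 1) and -1 (bit 0). By induction on n, the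
   first vertices of the paths in P_2n(k,k+1) are the paths with k up-steps that stay weakly above
   the axis and return to it, the second vertices are those with k + 1 up-steps that stay strictly
   above it, and the last vertices are those with k up-steps that go below it exactly once; the
   vertices of B_2n(k) not visited are those strictly above the axis, of which there are none for
   k = n. For k = n these classes of first and of last vertices are each invariant under f_alpha.
   Hence, going forwards along P o (0) and backwards along f_alpha(P) o (1), the matching edges
   lead consistently from ends to starts: C_{2n+1} is a disjoint union of directed cycles, and
   cutting it at the first edges of P o (0) gives the paths P'. *)
theory Submission
  imports Defs
begin


section \<open>Arcs of paths\<close>

text \<open>Why the classes are invariant under \<open>f_map\<close>: complement and reversal mirror
  a path of total 0 in time, so negative heights only change places. \<open>pi_map\<close> exchanges
  two neighbouring steps between consecutive odd indices, so it alters heights at even indices only,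
  and a path with at most one negative height is never negative there, before or after the swaps.
  This is what admits arbitrary parameters. Why the induction closes: above the new middle level two
  appended bits produce positive heights only and do not change the class. At the new middle level
  the total is 0, and the suffix 01 adds the single dip to a path without dips; hence the paths of
  P' may end at first vertices of old paths. Graphs are handled as sets of arcs whose directions are
  forgotten by \<open>uedges\<close>; with one arc in and one arc out at each vertex, degrees and
  orientations of cycles are immediate. The components are not searched for: they are written down
  as lists, and the edge sets are compared.\<close>

definition uedges :: "('v \<times> 'v) set \<Rightarrow> 'v set set" where
  "uedges A = {{u, v} | u v. (u, v) \<in> A}"

lemma uedges_Un: "uedges (A \<union> B) = uedges A \<union> uedges B"
  by (auto simp: uedges_def)

lemma uedges_UN: "uedges (\<Union>i\<in>I. A i) = (\<Union>i\<in>I. uedges (A i))"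
  by (auto simp: uedges_def)

lemma uedges_converse: "uedges (A\<inverse>) = uedges A"
  by (auto simp: uedges_def insert_commute)

lemma uedges_eq_image: "uedges A = (\<lambda>(u, v). {u, v}) ` A"
  by (auto simp: uedges_def)

lemma uedges_image: "uedges (map_prod g g ` A) = (`) g ` uedges A"
  by (simp add: uedges_eq_image image_image case_prod_beta)

lemma uedges_insert: "uedges (insert (u, v) A) = insert {u, v} (uedges A)"
  by (auto simp: uedges_def)

lemma uedges_empty [simp]: "uedges {} = {}"
  by (simp add: uedges_def)

lemma uedgesE:
  assumes "e \<in> uedges A"
  obtains u v where "(u, v) \<in> A" "e = {u, v}"
  using assms by (auto simp: uedges_def)

lemma uedges_pair_iff: "{u, v} \<in> uedges A \<longleftrightarrow> (u, v) \<in> A \<or> (v, u) \<in> A"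
  by (auto simp: uedges_def doubleton_eq_iff)

text \<open>Replaces indices by list recursion, so that later facts about arcs go by induction on
  the list.\<close>

lemma arcs_path_zip: "arcs_path p = set (zip p (tl p))"
  by (auto simp: arcs_path_def set_zip nth_tl)

lemma arcs_path_Nil [simp]: "arcs_path [] = {}"
  and arcs_path_single [simp]: "arcs_path [x] = {}"
  and arcs_path_Cons [simp]: "arcs_path (x # y # xs) = insert (x, y) (arcs_path (y # xs))"
  by (auto simp: arcs_path_zip)

lemma arcs_path_Cons': "xs \<noteq> [] \<Longrightarrow> arcs_path (x # xs) = insert (x, hd xs) (arcs_path xs)"
  by (cases xs) auto

lemma arcs_path_append:
  "xs \<noteq> [] \<Longrightarrow> ys \<noteq> [] \<Longrightarrow>
    arcs_path (xs @ ys) = arcs_path xs \<union> {(last xs, hd ys)} \<union> arcs_path ys"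
proof (induction xs)
  case (Cons x xs)
  then show ?case by (cases xs) (auto simp: arcs_path_Cons')
qed simp

lemma arcs_path_map: "arcs_path (map g p) = map_prod g g ` arcs_path p"
  by (induction p rule: induct_list012) auto

lemma arcs_path_rev: "arcs_path (rev p) = (arcs_path p)\<inverse>"
proof (induction p)
  case (Cons x xs)
  then show ?case
    by (cases "xs = []") (auto simp: arcs_path_append last_rev arcs_path_Cons')
qed simp

lemma arcs_path_subset: "arcs_path p \<subseteq> set p \<times> set p"
  by (auto simp: arcs_path_def)

lemma arcs_path_Domain: "distinct p \<Longrightarrow> p \<noteq> [] \<Longrightarrow> Domain (arcs_path p) = set p - {last p}"
  by (induction p rule: induct_list012) auto

lemma arcs_path_Range: "distinct p \<Longrightarrow> p \<noteq> [] \<Longrightarrow> Range (arcs_path p) = set p - {hd p}"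
  using arcs_path_Domain[of "rev p"] by (simp add: arcs_path_rev last_rev)

lemma single_valued_arcs_path: "distinct p \<Longrightarrow> single_valued (arcs_path p)"
  by (auto simp: single_valued_def arcs_path_def nth_eq_iff_index_eq)

lemma arcs_path_antisym: "distinct p \<Longrightarrow> (u, v) \<in> arcs_path p \<Longrightarrow> (v, u) \<notin> arcs_path p"
  by (auto simp: arcs_path_def nth_eq_iff_index_eq)

lemma edges_path_graph: "edges (path_graph p) = uedges (arcs_path p)"
  by (simp add: path_graph_def uedges_def)

lemma verts_path_graph [simp]: "verts (path_graph p) = set p"
  by (simp add: path_graph_def)

section \<open>Families of pairwise disjoint paths\<close>

definition disjoint_paths :: "'v opath set \<Rightarrow> bool" where
  "disjoint_paths P \<longleftrightarrow> (\<forall>p\<in>P. is_opath p) \<and> pairwise (\<lambda>p q. set p \<inter> set q = {}) P"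

lemma is_opath_nonempty: "is_opath p \<Longrightarrow> p \<noteq> []"
  by (auto simp: is_opath_def)

lemma disjoint_pathsD: "disjoint_paths P \<Longrightarrow> p \<in> P \<Longrightarrow> is_opath p"
  by (simp add: disjoint_paths_def)

lemma disjoint_paths_eq:
  "disjoint_paths P \<Longrightarrow> p \<in> P \<Longrightarrow> q \<in> P \<Longrightarrow> x \<in> set p \<Longrightarrow> x \<in> set q \<Longrightarrow> p = q"
  by (auto simp: disjoint_paths_def pairwise_def)

lemma path_vertices:
  assumes "is_opath p"
  shows "first_v p \<in> set p" "second_v p \<in> set p" "last_v p \<in> set p"
    "(first_v p, second_v p) \<in> arcs_path p" "first_v p \<noteq> second_v p"
proof -
  obtain x y r where "p = x # y # r"
    using assms by (metis is_opath_def One_nat_def Suc_1 Suc_le_length_iff)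
  then show "first_v p \<in> set p" "second_v p \<in> set p" "last_v p \<in> set p"
    "(first_v p, second_v p) \<in> arcs_path p" "first_v p \<noteq> second_v p"
    using assms by (auto simp: first_v_def second_v_def last_v_def is_opath_def)
qed

text \<open>In a disjoint family a vertex determines its path, so uniqueness of successors on single
  paths carries over to the union; predecessors are successors on the reversed paths.\<close>

lemma single_valued_UN_arcs:
  assumes "disjoint_paths P"
  shows "single_valued (\<Union>p\<in>P. arcs_path p)" "single_valued ((\<Union>p\<in>P. arcs_path p)\<inverse>)"
proof -
  have sub: "(u, v) \<in> arcs_path p \<Longrightarrow> u \<in> set p \<and> v \<in> set p" for u v :: 'a and p
    using arcs_path_subset by fastforce
  have sv: "single_valued (arcs_path p)" "single_valued ((arcs_path p)\<inverse>)" if "p \<in> P" for p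
    using single_valued_arcs_path[of p] single_valued_arcs_path[of "rev p"] disjoint_pathsD[OF assms that]
    by (auto simp: arcs_path_rev is_opath_def)
  show "single_valued (\<Union>p\<in>P. arcs_path p)"
    unfolding single_valued_def
    using sub sv(1) disjoint_paths_eq[OF assms] by (metis (no_types, lifting) UN_E single_valued_def)
  show "single_valued ((\<Union>p\<in>P. arcs_path p)\<inverse>)"
    unfolding single_valued_def
    using sub sv(2) disjoint_paths_eq[OF assms]
    by (metis (no_types, lifting) UN_E single_valued_def converse_iff)
qed

lemma UN_arcs_antisym:
  assumes "disjoint_paths P" "(u, v) \<in> (\<Union>p\<in>P. arcs_path p)"
  shows "(v, u) \<notin> (\<Union>p\<in>P. arcs_path p)"
proof
  assume "(v, u) \<in> (\<Union>p\<in>P. arcs_path p)"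
  then obtain p q where *: "p \<in> P" "q \<in> P" "(u, v) \<in> arcs_path p" "(v, u) \<in> arcs_path q"
    using assms(2) by blast
  then have "p = q"
    using arcs_path_subset disjoint_paths_eq[OF assms(1)] by fastforce
  then show False
    using * arcs_path_antisym disjoint_pathsD[OF assms(1)] by (metis is_opath_def)
qed

text \<open>Each path lacks an outgoing arc only at its own last vertex; by disjointness, removing
  the last vertices of all paths removes nothing more from it.\<close>

lemma Domain_UN_arcs:
  assumes "disjoint_paths P"
  shows "Domain (\<Union>p\<in>P. arcs_path p) = visited P - last_v ` P"
proof -
  have "Domain (arcs_path p) = set p - last_v ` P" if p: "p \<in> P" for p
  proof -
    have "last_v q \<in> set p \<Longrightarrow> q \<in> P \<Longrightarrow> q = p" for q
      using disjoint_paths_eq[OF assms] p path_vertices(3) disjoint_pathsD[OF assms] by metis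
    then have "set p - {last p} = set p - last_v ` P"
      using p by (auto simp: last_v_def)
    then show ?thesis
      using arcs_path_Domain disjoint_pathsD[OF assms p] is_opath_nonempty by (metis is_opath_def)
  qed
  then show ?thesis by (auto simp: visited_def Domain_Union)
qed

lemma Range_UN_arcs:
  assumes "disjoint_paths P"
  shows "Range (\<Union>p\<in>P. arcs_path p) = visited P - first_v ` P"
proof -
  have "Range (arcs_path p) = set p - first_v ` P" if p: "p \<in> P" for p
  proof -
    have "first_v q \<in> set p \<Longrightarrow> q \<in> P \<Longrightarrow> q = p" for q
      using disjoint_paths_eq[OF assms] p path_vertices(1) disjoint_pathsD[OF assms] by metis
    then have "set p - {hd p} = set p - first_v ` P"
      using p by (auto simp: first_v_def)
    then show ?thesis
      using arcs_path_Range disjoint_pathsD[OF assms p] is_opath_nonempty by (metis is_opath_def)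
  qed
  then show ?thesis by (auto simp: visited_def Range_Union)
qed

lemma inj_on_endpoints:
  assumes "disjoint_paths P"
  shows "inj_on first_v P" "inj_on last_v P" "inj_on second_v P"
  using disjoint_paths_eq[OF assms] path_vertices disjoint_pathsD[OF assms]
  by (metis inj_onI)+

lemma disjoint_paths_map:
  assumes "disjoint_paths P" "inj_on g (visited P)"
  shows "disjoint_paths (map g ` P)"
proof -
  have sub: "set p \<subseteq> visited P" if "p \<in> P" for p
    using that by (auto simp: visited_def)
  have "is_opath (map g p)" if "p \<in> P" for p
    using that assms sub[OF that] by (auto simp: disjoint_paths_def is_opath_def distinct_map inj_on_subset)
  moreover have "g ` set p \<inter> g ` set q = {}" if "p \<in> P" "q \<in> P" "p \<noteq> q" for p q
    using that inj_on_image_Int[OF assms(2) sub[OF that(1)] sub[OF that(2)]] assms(1)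
    by (auto simp: disjoint_paths_def pairwise_def)
  ultimately show ?thesis
    by (fastforce simp: disjoint_paths_def pairwise_def)
qed

lemma disjoint_paths_Un:
  assumes "disjoint_paths P" "disjoint_paths Q" "visited P \<inter> visited Q = {}"
  shows "disjoint_paths (P \<union> Q)"
proof -
  have "set p \<inter> set q = {}" if "p \<in> P" "q \<in> Q" for p q
    using assms(3) that by (auto simp: visited_def)
  then show ?thesis
    using assms(1,2) unfolding disjoint_paths_def pairwise_def
    by (metis Int_commute UnE)
qed

lemma visited_Un: "visited (P \<union> Q) = visited P \<union> visited Q"
  by (auto simp: visited_def)

lemma visited_map: "visited (map g ` P) = g ` visited P"
  by (auto simp: visited_def)

lemma endpoints_map:
  assumes "disjoint_paths P"
  shows "first_v ` map g ` P = g ` first_v ` P" "second_v ` map g ` P = g ` second_v ` P"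
    "last_v ` map g ` P = g ` last_v ` P"
proof -
  have "p \<noteq> []" "1 < length p" if "p \<in> P" for p
    using disjoint_pathsD[OF assms that] by (auto simp: is_opath_def)
  then show "first_v ` map g ` P = g ` first_v ` P" "second_v ` map g ` P = g ` second_v ` P"
    "last_v ` map g ` P = g ` last_v ` P"
    unfolding image_image
    by (auto simp: first_v_def second_v_def last_v_def hd_map last_map intro!: image_cong)
qed

text \<open>The first vertex lies on one edge only, which fixes the second vertex, and the two tails
  satisfy the same hypotheses. This yields the uniqueness of the orientation of a component.\<close>

lemma arcs_path_inj:
  assumes "distinct p" "distinct q" "p \<noteq> []" "q \<noteq> []" "hd p = hd q"
    "uedges (arcs_path p) = uedges (arcs_path q)"
  shows "p = q"
  using assms
proof (induction p arbitrary: q rule: induct_list012)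
  case (2 x)
  then show ?case by (cases q rule: remdups_adj.cases) (auto simp: uedges_insert)
next
  case (3 x y r)
  then obtain z s where q: "q = x # z # s"
    by (cases q rule: remdups_adj.cases) (auto simp: uedges_insert)
  have notin: "e \<in> uedges (arcs_path (w # t)) \<Longrightarrow> x \<notin> e" if "x \<notin> set (w # t)" for w t e
    using that arcs_path_subset[of "w # t"] by (auto elim!: uedgesE)
  have y: "x \<notin> set (y # r)" and z: "x \<notin> set (z # s)"
    using 3 q by auto
  have eq: "insert {x, y} (uedges (arcs_path (y # r))) = insert {x, z} (uedges (arcs_path (z # s)))"
    using "3.prems" by (simp add: q uedges_insert)
  have "{x, y} \<in> insert {x, z} (uedges (arcs_path (z # s)))"
    using eq by blast
  then have "y = z"
    using notin[OF z, of "{x, y}"] by (auto simp: doubleton_eq_iff)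
  have "{x, y} \<notin> uedges (arcs_path (y # r))" "{x, y} \<notin> uedges (arcs_path (z # s))"
    using notin[OF y] notin[OF z] by blast+
  then have "uedges (arcs_path (y # r)) = uedges (arcs_path (z # s))"
    using eq \<open>y = z\<close> by (metis insert_ident)
  then have "y # r = z # s"
    using "3.prems" q \<open>y = z\<close> by (intro "3.IH"(2)) auto
  then show ?case using q by simp
qed simp

section \<open>Graphs given by a relation\<close>

text \<open>The two edges at \<open>v\<close> are its outgoing and its incoming arc. Antisymmetry
  keeps them from being the same edge.\<close>

lemma degree_uedges:
  assumes "edges G = uedges D" "single_valued D" "single_valued (D\<inverse>)"
    "\<And>u v. (u, v) \<in> D \<Longrightarrow> (v, u) \<notin> D" "v \<in> Domain D" "v \<in> Range D"
  shows "degree G v = 2"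
proof -
  obtain u w where uw: "(v, w) \<in> D" "(u, v) \<in> D"
    using assms(5,6) by auto
  have "{e \<in> edges G. v \<in> e} = {{v, w}, {u, v}}"
    using uw assms(2,3) unfolding assms(1)
    by (auto simp: uedges_pair_iff single_valued_def elim!: uedgesE)
  moreover have "{v, w} \<noteq> {u, v}"
    using uw assms(4) by (metis doubleton_eq_iff)
  ultimately show ?thesis by (simp add: degree_def)
qed

text \<open>If one arc of the cycle agrees with \<open>D\<close>, so does the next: otherwise the
  vertex between them would have both its neighbours on the cycle as predecessors.\<close>

lemma cycle_forward:
  assumes "single_valued (D\<inverse>)" "distinct c" "3 \<le> length c"
    and arcs: "\<And>u v. (u, v) \<in> arcs_cycle c \<Longrightarrow> (u, v) \<in> D \<or> (v, u) \<in> D"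
    and start: "(c ! 0, c ! 1) \<in> D"
  shows "arcs_cycle c \<subseteq> D"
proof -
  let ?m = "length c"
  have m: "0 < ?m" "Suc 0 < ?m" using assms(3) by linarith+
  have *: "(c ! (i mod length c), c ! (Suc i mod length c)) \<in> D" for i
  proof (induction i)
    case 0
    then show ?case using start m by simp
  next
    case (Suc i)
    have "(c ! (Suc i mod ?m), c ! (Suc (Suc i mod ?m) mod ?m)) \<in> arcs_cycle c"
      unfolding arcs_cycle_def using m by force
    then have "(c ! (Suc i mod ?m), c ! (Suc (Suc i) mod ?m)) \<in> D
      \<or> (c ! (Suc (Suc i) mod ?m), c ! (Suc i mod ?m)) \<in> D"
      using arcs by (simp add: mod_Suc_eq)
    \<comment> \<open>Here \<open>3 \<le> length c\<close> enters: on a closed walk of length 2 the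
      indices \<open>i\<close> and \<open>i + 2\<close> would coincide.\<close>
    moreover have "c ! (Suc (Suc i) mod ?m) \<noteq> c ! (i mod ?m)"
    proof
      assume "c ! (Suc (Suc i) mod ?m) = c ! (i mod ?m)"
      then have "(i + 2) mod ?m = (i + 0) mod ?m"
        using m assms(2) by (simp add: nth_eq_iff_index_eq)
      then have "?m dvd 2"
        using mod_eq_dvd_iff_nat[of i "i + 2" ?m] by simp
      then show False
        using assms(3) by (auto dest: dvd_imp_le)
    qed
    ultimately show ?case
      using Suc assms(1) by (auto simp: single_valued_def)
  qed
  show ?thesis
    using *[of i for i] by (auto simp: arcs_cycle_def) (metis mod_less)
qed

text \<open>The first edge decides; if it runs against \<open>D\<close>, the same propagation
  applies to the converse of \<open>D\<close>.\<close>

lemma cycle_orientation: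
  assumes "single_valued D" "single_valued (D\<inverse>)" "distinct c" "3 \<le> length c"
    and arcs: "\<And>u v. (u, v) \<in> arcs_cycle c \<Longrightarrow> (u, v) \<in> D \<or> (v, u) \<in> D"
  shows "arcs_cycle c \<subseteq> D \<or> arcs_cycle c \<subseteq> D\<inverse>"
proof -
  have "(c ! 0, c ! (Suc 0 mod length c)) \<in> arcs_cycle c"
    unfolding arcs_cycle_def using assms(4) by force
  then have "(c ! 0, c ! 1) \<in> D \<or> (c ! 0, c ! 1) \<in> D\<inverse>"
    using arcs assms(4) by auto
  then show ?thesis
    using cycle_forward[of D c] cycle_forward[of "D\<inverse>" c] assms by auto
qed

lemma arcs_cycle_rev: "(u, v) \<in> arcs_cycle c \<Longrightarrow> (v, u) \<in> arcs_cycle (rev c)"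
proof -
  let ?m = "length c"
  assume "(u, v) \<in> arcs_cycle c"
  then obtain i where i: "i < ?m" "u = c ! i" "v = c ! (Suc i mod ?m)"
    by (auto simp: arcs_cycle_def)
  \<comment> \<open>\<open>rev\<close> moves index \<open>l\<close> to
    \<open>length c - Suc l\<close>, so \<open>j\<close> is the new place of \<open>v\<close>. The
    closing arc of \<open>c\<close> has \<open>j = length c - 1\<close> and becomes, reversed, the
    closing arc of \<open>rev c\<close>.\<close>
  define j where "j = ?m - Suc (Suc i mod ?m)"
  have j: "j < ?m" using i by (auto simp: j_def)
  have "Suc i mod ?m < ?m" using i(1) by (intro mod_less_divisor) linarith
  then have "rev c ! j = v"
    using i j by (simp add: rev_nth j_def)
  moreover have "rev c ! (Suc j mod ?m) = u"
  proof (cases "Suc i = ?m")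
    case True
    then have "Suc j = ?m" using i(1) by (simp add: j_def)
    then have "Suc j mod ?m = 0" by simp
    moreover have "rev c ! 0 = c ! i"
      using i(1) by (simp add: rev_nth flip: True)
    ultimately show ?thesis using i(2) by simp
  next
    case False
    then have "Suc j = ?m - Suc i" "Suc j < ?m" using i by (auto simp: j_def)
    then show ?thesis using i by (simp add: rev_nth)
  qed
  ultimately show ?thesis
    using j unfolding arcs_cycle_def by force
qed

section \<open>Connected components of a disjoint family of paths\<close>

lemma adjacency_rtrancl_sym: "(u, v) \<in> (adjacency G)\<^sup>* \<Longrightarrow> (v, u) \<in> (adjacency G)\<^sup>*"
proof -
  have "sym (adjacency G)"
    by (auto simp: sym_def adjacency_def insert_commute)
  then show "(u, v) \<in> (adjacency G)\<^sup>* \<Longrightarrow> (v, u) \<in> (adjacency G)\<^sup>*"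
    using sym_rtrancl by (metis symD)
qed

lemma rtrancl_path: "x \<in> set p \<Longrightarrow> (hd p, x) \<in> (arcs_path p)\<^sup>*"
proof (induction p rule: induct_list012)
  case (3 y z r)
  show ?case
  proof (cases "x = y")
    case False
    then have "(z, x) \<in> (arcs_path (z # r))\<^sup>*" using 3 by simp
    then have "(z, x) \<in> (arcs_path (y # z # r))\<^sup>*"
      by (metis arcs_path_Cons rtrancl_mono subsetD subset_insertI)
    then show ?thesis
      using converse_rtrancl_into_rtrancl[of y z "arcs_path (y # z # r)" x] by simp
  qed simp
qed auto

text \<open>The head of \<open>q\<close> reaches every vertex of \<open>q\<close>, and adjacency is
  symmetric. Nothing else is reached, because an edge touching \<open>q\<close> can only come from
  \<open>q\<close> itself.\<close>

lemma component_of_family_graph: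
  assumes "disjoint_paths Q" "q \<in> Q" "v \<in> set q"
  shows "component_of (family_graph Q) v = path_graph q"
proof -
  let ?G = "family_graph Q"
  have edges: "edges ?G = (\<Union>p\<in>Q. uedges (arcs_path p))"
    by (simp add: family_graph_def edges_path_graph)
  have arc: "(u, w) \<in> arcs_path q" if "u \<in> set q \<or> w \<in> set q" "(u, w) \<in> arcs_path p" "p \<in> Q" for u w p
    using that disjoint_paths_eq[OF assms(1) assms(2)] arcs_path_subset[of p] by blast
  have "arcs_path q \<subseteq> adjacency ?G"
    using assms(2) by (auto simp: adjacency_def edges uedges_pair_iff)
  then have reach: "(hd q, w) \<in> (adjacency ?G)\<^sup>*" if "w \<in> set q" for w
    using rtrancl_path[OF that] rtrancl_mono by blast
  have "w \<in> set q" if "(v, w) \<in> (adjacency ?G)\<^sup>*" for w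
    using that
  proof (induction rule: rtrancl_induct)
    case (step y z)
    then obtain p where "p \<in> Q" "(y, z) \<in> arcs_path p \<or> (z, y) \<in> arcs_path p"
      by (auto simp: adjacency_def edges uedges_pair_iff)
    then have "(y, z) \<in> arcs_path q \<or> (z, y) \<in> arcs_path q"
      using arc step by blast
    then show ?case using arcs_path_subset[of q] by blast
  qed (fact assms(3))
  moreover have "(v, w) \<in> (adjacency ?G)\<^sup>*" if "w \<in> set q" for w
    using reach[OF that] adjacency_rtrancl_sym[OF reach[OF assms(3)]] by (rule rtrancl_trans[rotated])
  ultimately have W: "{w. (v, w) \<in> (adjacency ?G)\<^sup>*} = set q" by blast
  have "{e \<in> edges ?G. e \<subseteq> set q} = uedges (arcs_path q)"
    unfolding edges using arc assms(2) arcs_path_subset[of q]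
    by (fastforce elim!: uedgesE simp: uedges_pair_iff)
  then show ?thesis
    unfolding component_of_def Let_def W by (simp add: path_graph_def uedges_def)
qed

lemma components_family_graph:
  assumes "disjoint_paths Q"
  shows "components (family_graph Q) = path_graph ` Q"
proof -
  have "verts (family_graph Q) = (\<Union>q\<in>Q. set q)"
    by (simp add: family_graph_def visited_def)
  moreover have "\<exists>v. v \<in> set q" if "q \<in> Q" for q
    using disjoint_pathsD[OF assms that] path_vertices(1) by blast
  ultimately show ?thesis
    unfolding components_def
    using component_of_family_graph[OF assms] by (auto simp: image_iff)
qed


section \<open>Lattice paths\<close>

definition height :: "bits \<Rightarrow> nat \<Rightarrow> int" where
  "height x i = (\<Sum>j<i. if x ! j then 1 else - 1)"

abbreviation total :: "bits \<Rightarrow> int" where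
  "total x \<equiv> height x (length x)"

definition nonneg_path :: "bits \<Rightarrow> bool" where
  "nonneg_path x \<longleftrightarrow> (\<forall>i\<le>length x. 0 \<le> height x i)"

text \<open>The range starts at 1 since every path starts at height 0. The empty path counts as
  positive, which is why \<open>pos_total\<close> asks for \<open>x \<noteq> []\<close>.\<close>

definition pos_path :: "bits \<Rightarrow> bool" where
  "pos_path x \<longleftrightarrow> (\<forall>i\<in>{1..length x}. 0 < height x i)"

definition dips_once :: "bits \<Rightarrow> bool" where
  "dips_once x \<longleftrightarrow> (\<exists>!i. i \<le> length x \<and> height x i < 0)"

definition touching :: "nat \<Rightarrow> nat \<Rightarrow> bits set" where
  "touching m k = {x \<in> layer m k. nonneg_path x \<and> \<not> pos_path x}"

definition positive :: "nat \<Rightarrow> nat \<Rightarrow> bits set" where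
  "positive m k = {x \<in> layer m k. pos_path x}"

definition dipping :: "nat \<Rightarrow> nat \<Rightarrow> bits set" where
  "dipping m k = {x \<in> layer m k. dips_once x}"

lemma height_0 [simp]: "height x 0 = 0"
  and height_Suc: "height x (Suc i) = height x i + (if x ! i then 1 else - 1)"
  by (simp_all add: height_def)

lemma height_append: "i \<le> length x \<Longrightarrow> height (x @ y) i = height x i"
  unfolding height_def by (intro sum.cong) (auto simp: nth_append)

lemma total_snoc: "total (x @ [b]) = total x + (if b then 1 else - 1)"
  by (simp add: height_Suc height_append)

lemma total_count: "total x = 2 * int (count_list x True) - int (length x)"
proof (induction x rule: rev_induct)
  case (snoc b x)
  then show ?case unfolding total_snoc by simp
qed simp

lemma even_height: "even (height x i) \<longleftrightarrow> even i"
  by (induction i) (auto simp: height_Suc)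

lemma nonneg_path_snoc: "nonneg_path (x @ [b]) \<longleftrightarrow> nonneg_path x \<and> 0 \<le> total (x @ [b])"
  unfolding nonneg_path_def by (auto simp: le_Suc_eq height_append)

lemma pos_path_snoc: "pos_path (x @ [b]) \<longleftrightarrow> pos_path x \<and> 0 < total (x @ [b])"
proof -
  have "{1..length (x @ [b])} = insert (Suc (length x)) {1..length x}"
    by auto
  then show ?thesis
    unfolding pos_path_def by (auto simp: height_append)
qed

lemma dips_once_snoc:
  "dips_once (x @ [b]) \<longleftrightarrow>
    dips_once x \<and> 0 \<le> total (x @ [b]) \<or> nonneg_path x \<and> total (x @ [b]) < 0"
proof -
  let ?t = "total (x @ [b])"
  have "i \<le> length (x @ [b]) \<and> height (x @ [b]) i < 0 \<longleftrightarrow>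
      i \<le> length x \<and> height x i < 0 \<or> i = Suc (length x) \<and> ?t < 0" for i
    by (cases "i = Suc (length x)") (auto simp: height_append le_Suc_eq)
  then have *: "dips_once (x @ [b]) \<longleftrightarrow>
      (\<exists>!i. i \<le> length x \<and> height x i < 0 \<or> i = Suc (length x) \<and> ?t < 0)"
    unfolding dips_once_def by presburger
  show ?thesis
  proof (cases "?t < 0")
    case True
    have "dips_once (x @ [b]) \<longleftrightarrow> (\<forall>i\<le>length x. \<not> height x i < 0)"
      unfolding * using True by (metis Suc_n_not_le_n)
    then show ?thesis
      using True by (auto simp: nonneg_path_def not_less)
  next
    case False
    then show ?thesis unfolding * by (simp add: dips_once_def)
  qed
qed

lemma pos_imp_nonneg: "pos_path x \<Longrightarrow> nonneg_path x"
  unfolding nonneg_path_def pos_path_def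
  by (metis atLeastAtMost_iff height_0 less_eq_Suc_le less_imp_le not_gr_zero One_nat_def order_refl)

lemma nonneg_total: "nonneg_path x \<Longrightarrow> 0 \<le> total x"
  by (simp add: nonneg_path_def)

lemma pos_total: "pos_path x \<Longrightarrow> x \<noteq> [] \<Longrightarrow> 0 < total x"
  by (cases x) (simp_all add: pos_path_def)

lemma path_snoc2:
  shows "nonneg_path (x @ [a, b]) \<longleftrightarrow>
      nonneg_path x \<and> 0 \<le> total (x @ [a]) \<and> 0 \<le> total (x @ [a, b])"
    and "pos_path (x @ [a, b]) \<longleftrightarrow>
      pos_path x \<and> 0 < total (x @ [a]) \<and> 0 < total (x @ [a, b])"
    and "dips_once (x @ [a, b]) \<longleftrightarrow>
      dips_once x \<and> 0 \<le> total (x @ [a]) \<and> 0 \<le> total (x @ [a, b])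
      \<or> nonneg_path x \<and> total (x @ [a]) < 0 \<and> 0 \<le> total (x @ [a, b])
      \<or> nonneg_path x \<and> 0 \<le> total (x @ [a]) \<and> total (x @ [a, b]) < 0"
  using nonneg_path_snoc[of "x @ [a]" b] pos_path_snoc[of "x @ [a]" b] dips_once_snoc[of "x @ [a]" b]
    nonneg_path_snoc[of x a] pos_path_snoc[of x a] dips_once_snoc[of x a]
  by auto

lemma layer_snoc2:
  "x @ [a, b] \<in> layer (2 * Suc n) k \<longleftrightarrow>
    length x = 2 * n \<and> count_list x True + of_bool a + of_bool b = k"
  by (auto simp: layer_def)

lemma layer_total: "x \<in> layer m k \<Longrightarrow> total x = 2 * int k - int m"
  using total_count[of x] by (auto simp: layer_def)

text \<open>In these layers the path ends at height \<open>2 * k - 2 * n - 2 \<ge> 2\<close>, so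
  both appended heights are positive and the class is decided by \<open>x\<close> alone.\<close>

lemma classes_snoc2:
  assumes "1 \<le> n" "n + 2 \<le> k"
  shows "x @ [a, b] \<in> layer (2 * Suc n) k \<longleftrightarrow> x \<in> layer (2 * n) (k - of_bool a - of_bool b)"
    and "x @ [a, b] \<in> positive (2 * Suc n) k \<longleftrightarrow> x \<in> positive (2 * n) (k - of_bool a - of_bool b)"
    and "x @ [a, b] \<in> touching (2 * Suc n) k \<longleftrightarrow> x \<in> touching (2 * n) (k - of_bool a - of_bool b)"
    and "x @ [a, b] \<in> dipping (2 * Suc n) k \<longleftrightarrow> x \<in> dipping (2 * n) (k - of_bool a - of_bool b)"
proof -
  let ?k = "k - of_bool a - of_bool b"
  show L: "x @ [a, b] \<in> layer (2 * Suc n) k \<longleftrightarrow> x \<in> layer (2 * n) ?k"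
    unfolding layer_snoc2 using assms by (auto simp: layer_def)
  have t: "total x = 2 * int k - 2 * of_bool a - 2 * of_bool b - 2 * int n"
    "total (x @ [a]) = total x + (if a then 1 else - 1)"
    "total (x @ [a, b]) = 2 * int k - 2 * int n - 2" "x \<noteq> []" if "x \<in> layer (2 * n) ?k"
  proof -
    show "total x = 2 * int k - 2 * of_bool a - 2 * of_bool b - 2 * int n"
      using layer_total[OF that] assms by auto
    show "total (x @ [a]) = total x + (if a then 1 else - 1)"
      by (rule total_snoc)
    show "total (x @ [a, b]) = 2 * int k - 2 * int n - 2" "x \<noteq> []"
      using layer_total[of "x @ [a, b]"] L that assms by (auto simp: layer_def)
  qed
  have "pos_path (x @ [a, b]) \<longleftrightarrow> pos_path x" "nonneg_path (x @ [a, b]) \<longleftrightarrow> nonneg_path x"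
    "dips_once (x @ [a, b]) \<longleftrightarrow> dips_once x"
    if "x \<in> layer (2 * n) ?k"
  proof -
    note t = t[OF that]
    show "pos_path (x @ [a, b]) \<longleftrightarrow> pos_path x"
      unfolding path_snoc2 using t assms(2) pos_total[of x] by (cases a; cases b) auto
    show "nonneg_path (x @ [a, b]) \<longleftrightarrow> nonneg_path x"
      unfolding path_snoc2 using t assms(2) nonneg_total[of x] by (cases a; cases b) auto
    show "dips_once (x @ [a, b]) \<longleftrightarrow> dips_once x"
      unfolding path_snoc2 using t assms(2) by (cases a; cases b) auto
  qed
  then show "x @ [a, b] \<in> positive (2 * Suc n) k \<longleftrightarrow> x \<in> positive (2 * n) ?k"
    "x @ [a, b] \<in> touching (2 * Suc n) k \<longleftrightarrow> x \<in> touching (2 * n) ?k"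
    "x @ [a, b] \<in> dipping (2 * Suc n) k \<longleftrightarrow> x \<in> dipping (2 * n) ?k"
    using L by (auto simp: positive_def touching_def dipping_def)
qed

lemma touching_middle:
  assumes "1 \<le> n"
  shows "touching (2 * n) n = {x \<in> layer (2 * n) n. nonneg_path x}"
proof -
  have "\<not> pos_path x" if "x \<in> layer (2 * n) n" for x
  proof -
    have "total x = 0" "x \<noteq> []"
      using layer_total[OF that] that assms by (auto simp: layer_def)
    then show ?thesis using pos_total[of x] by auto
  qed
  then show ?thesis by (auto simp: touching_def)
qed

lemma positive_middle: "1 \<le> n \<Longrightarrow> positive (2 * n) n = {}"
  using touching_middle[of n] pos_imp_nonneg by (fastforce simp: positive_def touching_def)

text \<open>The total is now 0, so the height before the last step is 1 if the last bit is 0, and -1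
  if it is 1. In the second case this is already the one dip, which forces \<open>x\<close> to be
  nonnegative; the suffix 11 would start from height -2 and fails.\<close>

lemma classes_snoc2_middle:
  assumes "1 \<le> n"
  shows "x @ [False, False] \<in> touching (2 * Suc n) (Suc n) \<longleftrightarrow>
      x \<in> touching (2 * n) (Suc n) \<or> x \<in> positive (2 * n) (Suc n)"
    and "x @ [True, False] \<in> touching (2 * Suc n) (Suc n) \<longleftrightarrow> x \<in> touching (2 * n) n"
    and "x @ [b, True] \<notin> touching (2 * Suc n) (Suc n)"
    and "x @ [False, False] \<in> dipping (2 * Suc n) (Suc n) \<longleftrightarrow> x \<in> dipping (2 * n) (Suc n)"
    and "x @ [True, False] \<in> dipping (2 * Suc n) (Suc n) \<longleftrightarrow> x \<in> dipping (2 * n) n"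
    and "x @ [False, True] \<in> dipping (2 * Suc n) (Suc n) \<longleftrightarrow> x \<in> touching (2 * n) n"
    and "x @ [True, True] \<notin> dipping (2 * Suc n) (Suc n)"
proof -
  have t: "total (x @ [a, b]) = 0" "total (x @ [a]) = (if b then - 1 else 1)"
    "total x = (if b then - 1 else 1) + (if a then - 1 else 1)"
    if "x @ [a, b] \<in> layer (2 * Suc n) (Suc n)" for a b
    using layer_total[OF that] total_snoc[of "x @ [a]" b] total_snoc[of x a]
    by (auto split: if_splits)
  have l: "x @ [a, b] \<in> layer (2 * Suc n) (Suc n) \<longleftrightarrow>
      (if a \<and> b then x \<in> layer (2 * n) (n - 1) else if a \<or> b then x \<in> layer (2 * n) n
       else x \<in> layer (2 * n) (Suc n))" for a b
    unfolding layer_snoc2 using assms by (auto simp: layer_def)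
  show "x @ [False, False] \<in> touching (2 * Suc n) (Suc n) \<longleftrightarrow>
      x \<in> touching (2 * n) (Suc n) \<or> x \<in> positive (2 * n) (Suc n)"
    using t[of False False] l[of False False] pos_imp_nonneg[of x]
    by (auto simp: touching_def positive_def path_snoc2)
  show "x @ [True, False] \<in> touching (2 * Suc n) (Suc n) \<longleftrightarrow> x \<in> touching (2 * n) n"
    using t[of True False] l[of True False] touching_middle[of "Suc n"]
    unfolding touching_middle[OF assms] by (auto simp: path_snoc2)
  show "x @ [b, True] \<notin> touching (2 * Suc n) (Suc n)"
    using t[of b True] nonneg_total[of x] by (auto simp: touching_def path_snoc2)
  show "x @ [False, False] \<in> dipping (2 * Suc n) (Suc n) \<longleftrightarrow> x \<in> dipping (2 * n) (Suc n)"
    using t[of False False] l[of False False] by (auto simp: dipping_def path_snoc2)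
  show "x @ [True, False] \<in> dipping (2 * Suc n) (Suc n) \<longleftrightarrow> x \<in> dipping (2 * n) n"
    using t[of True False] l[of True False] by (auto simp: dipping_def path_snoc2)
  show "x @ [False, True] \<in> dipping (2 * Suc n) (Suc n) \<longleftrightarrow> x \<in> touching (2 * n) n"
    using t[of False True] l[of False True]
    unfolding touching_middle[OF assms] by (auto simp: dipping_def path_snoc2)
  show "x @ [True, True] \<notin> dipping (2 * Suc n) (Suc n)"
    using t[of True True] nonneg_total[of x] by (auto simp: dipping_def path_snoc2)
qed

text \<open>Keeps the two directions of the matching edges apart in
  \<open>directed_antisym\<close>.\<close>

lemma touching_not_dipping: "x \<in> touching m k \<Longrightarrow> x \<notin> dipping m k"
  by (auto simp: touching_def dipping_def nonneg_path_def dips_once_def not_less)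

section \<open>The maps \<open>f\<^sub>\<alpha>\<close>\<close>

lemma length_pi_map [simp]: "length (pi_map a x) = length x"
  by (simp add: pi_map_def del: upt_Suc)

lemma length_f_map [simp]: "length (f_map a x) = length x"
  by (simp add: f_map_def)

lemma pi_map_nth: "i < length x \<Longrightarrow> pi_map a x ! i = x ! (swap_position a (Suc i) - 1)"
  by (simp add: pi_map_def bit_at_def del: upt_Suc)

lemma swap_position_involution: "swap_position a (swap_position a j) = j"
  by (auto simp: swap_position_def Let_def elim!: oddE evenE)

lemma swap_position_range:
  "length a + 1 = n \<Longrightarrow> j \<in> {1..2 * n} \<Longrightarrow> swap_position a j \<in> {1..2 * n}"
  by (auto simp: swap_position_def Let_def elim!: oddE evenE)

text \<open>Index \<open>i\<close> counts from 0; before \<open>rev\<close> it is position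
  \<open>length x - i\<close> counted from 1, and the final \<open>- 1\<close> returns to list
  indices.\<close>

lemma f_map_nth:
  "i < length x \<Longrightarrow> f_map a x ! i = (\<not> x ! (swap_position a (length x - i) - 1))"
  using pi_map_nth[of "length x - Suc i" x a] by (simp add: f_map_def rev_nth Suc_diff_Suc)

lemma bij_betw_f_map_index:
  assumes "length a + 1 = n"
  shows "bij_betw (\<lambda>i. swap_position a (2 * n - i) - 1) {..<2 * n} {..<2 * n}"
proof -
  let ?r = "\<lambda>i. swap_position a (2 * n - i) - 1"
  \<comment> \<open>The lower bound 1 is what makes the truncated \<open>- 1\<close> cancellable in
    the injectivity proof.\<close>
  have range: "swap_position a (2 * n - i) \<in> {1..2 * n}" if "i < 2 * n" for i
    using swap_position_range[OF assms, of "2 * n - i"] that by simp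
  have "inj_on ?r {..<2 * n}"
  proof (rule inj_onI)
    fix i j assume ij: "i \<in> {..<2 * n}" "j \<in> {..<2 * n}" "?r i = ?r j"
    then have "swap_position a (2 * n - i) = swap_position a (2 * n - j)"
      using range[of i] range[of j]
      by (metis atLeastAtMost_iff le_add_diff_inverse lessThan_iff)
    then have "2 * n - i = 2 * n - j"
      by (metis swap_position_involution)
    then show "i = j" using ij by simp
  qed
  moreover have "?r ` {..<2 * n} \<subseteq> {..<2 * n}"
    using range by fastforce
  ultimately show ?thesis
    by (simp add: bij_betw_def endo_inj_surj)
qed

text \<open>The cardinality from \<open>cube_layers\<close>, with \<open>length x\<close> for the
  dimension; meant for arguments of equal length.\<close>

definition hamming :: "bits \<Rightarrow> bits \<Rightarrow> nat" where
  "hamming x y = card {i. i < length x \<and> x ! i \<noteq> y ! i}"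

lemma hamming_commute: "length x = length y \<Longrightarrow> hamming x y = hamming y x"
  unfolding hamming_def by (rule arg_cong[where f = card]) auto

lemma hamming_append: "length x = length y \<Longrightarrow> hamming (x @ z) (y @ z) = hamming x y"
  unfolding hamming_def by (rule arg_cong[where f = card]) (auto simp: nth_append)

lemma hamming_bit: "b \<noteq> b' \<Longrightarrow> hamming (x @ b # z) (x @ b' # z) = 1"
proof -
  assume "b \<noteq> b'"
  then have "{i. i < length (x @ b # z) \<and> (x @ b # z) ! i \<noteq> (x @ b' # z) ! i} = {length x}"
    by (auto simp: nth_append nth_Cons')
  then show ?thesis by (simp add: hamming_def)
qed

text \<open>Permuting positions does not change how many of them satisfy \<open>R\<close>. With
  \<open>R\<close> comparing two strings this gives distances, with \<open>R\<close> testing for 0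
  the number of ones of the image.\<close>

lemma card_f_map_reindex:
  assumes "length a + 1 = n"
  shows "card {i. i < 2 * n \<and> R (swap_position a (2 * n - i) - 1)} = card {i. i < 2 * n \<and> R i}"
proof (rule bij_betw_same_card)
  let ?r = "\<lambda>i. swap_position a (2 * n - i) - 1"
  note bij = bij_betw_f_map_index[OF assms]
  show "bij_betw ?r {i. i < 2 * n \<and> R (?r i)} {i. i < 2 * n \<and> R i}"
    unfolding bij_betw_def
  proof
    show "inj_on ?r {i. i < 2 * n \<and> R (?r i)}"
      using bij unfolding bij_betw_def by (auto intro: inj_on_subset)
    have "?r ` {..<2 * n} = {..<2 * n}" using bij by (simp add: bij_betw_def)
    moreover have "{i. i < 2 * n \<and> R i} = {..<2 * n} \<inter> {i. R i}" by auto
    moreover have "?r ` {i. i < 2 * n \<and> R (?r i)} = ?r ` {..<2 * n} \<inter> {i. R i}" by auto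
    ultimately show "?r ` {i. i < 2 * n \<and> R (?r i)} = {i. i < 2 * n \<and> R i}" by simp
  qed
qed

lemma hamming_f_map:
  assumes "length a + 1 = n" "length x = 2 * n" "length y = 2 * n"
  shows "hamming (f_map a x) (f_map a y) = hamming x y"
proof -
  have "{i. i < length (f_map a x) \<and> f_map a x ! i \<noteq> f_map a y ! i}
      = {i. i < 2 * n \<and> x ! (swap_position a (2 * n - i) - 1) \<noteq> y ! (swap_position a (2 * n - i) - 1)}"
    using assms by (auto simp: f_map_nth)
  then show ?thesis
    using card_f_map_reindex[OF assms(1), of "\<lambda>i. x ! i \<noteq> y ! i"] assms(2)
    by (simp add: hamming_def)
qed

lemma count_list_card: "count_list x True = card {i. i < length x \<and> x ! i}"
proof -
  have "count_list x True = length (filter id x)"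
    by (induction x) auto
  then show ?thesis by (simp add: length_filter_conv_card)
qed

lemma count_list_f_map:
  assumes "length a + 1 = n" "length x = 2 * n"
  shows "count_list (f_map a x) True = 2 * n - count_list x True"
proof -
  have "count_list (f_map a x) True = card {i. i < 2 * n \<and> \<not> x ! (swap_position a (2 * n - i) - 1)}"
    unfolding count_list_card using assms(2) by (intro arg_cong[where f = card]) (auto simp: f_map_nth)
  also have "\<dots> = card ({..<2 * n} - {i. i < 2 * n \<and> x ! i})"
    unfolding card_f_map_reindex[OF assms(1), of "\<lambda>i. \<not> x ! i"]
    by (intro arg_cong[where f = card]) auto
  also have "\<dots> = 2 * n - count_list x True"
    unfolding count_list_card using assms(2) by (subst card_Diff_subset) auto
  finally show ?thesis .
qed

lemma finite_bits_length: "finite {x :: bits. length x = m}"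
  using finite_lists_length_eq[of "UNIV :: bool set" m] by simp

text \<open>Equal images have distance 0, and \<open>f_map\<close> preserves distances.\<close>

lemma inj_on_f_map:
  assumes "length a + 1 = n"
  shows "inj_on (f_map a) {x. length x = 2 * n}"
proof (rule inj_onI)
  fix x y assume xy: "x \<in> {x. length x = 2 * n}" "y \<in> {x. length x = 2 * n}" "f_map a x = f_map a y"
  let ?D = "{i. i < length x \<and> x ! i \<noteq> y ! i}"
  have "card ?D = 0"
    using hamming_f_map[OF assms, of x y] xy by (simp add: hamming_def)
  moreover have "finite ?D" by simp
  ultimately have "?D = {}" by (metis card_0_eq)
  then show "x = y" using xy by (auto intro: nth_equalityI)
qed

text \<open>Surjectivity comes from injectivity on the finite set of all strings of length
  \<open>2 * n\<close>; the layer of a preimage is then found by counting ones.\<close>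

lemma f_map_layer:
  assumes "length a + 1 = n" "k \<le> 2 * n"
  shows "f_map a ` layer (2 * n) k = layer (2 * n) (2 * n - k)"
proof -
  have count: "count_list (x :: bits) True \<le> 2 * n" if "length x = 2 * n" for x
    using that count_le_length[of x True] by simp
  have "f_map a ` {x. length x = 2 * n} = {x. length x = 2 * n}"
    using inj_on_f_map[OF assms(1)] finite_bits_length by (intro endo_inj_surj) auto
  then have "\<exists>x. y = f_map a x \<and> length x = 2 * n" if "length y = 2 * n" for y
    using that by blast
  then show ?thesis
    using assms(2) count by (fastforce simp: layer_def count_list_f_map[OF assms(1)] image_iff)
qed

text \<open>Swapping positions \<open>2 * i\<close> and \<open>2 * i + 1\<close> exchanges the two
  steps between the height indices \<open>2 * i - 1\<close> and \<open>2 * i + 1\<close>, so only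
  the height at index \<open>2 * i\<close> can change.\<close>

lemma height_pi_map_odd:
  assumes "length x = 2 * n" "length a + 1 = n" "i < n"
  shows "height (pi_map a x) (2 * i + 1) = height x (2 * i + 1)"
  using assms(3)
proof (induction i)
  case 0
  then show ?case
    using assms(1) by (simp add: height_Suc pi_map_nth swap_position_def)
next
  case (Suc i)
  define j where "j = Suc i"
  have *: "swap_position a (2 * j) = (if bit_at a j then 2 * j + 1 else 2 * j)"
    "swap_position a (Suc (2 * j)) = (if bit_at a j then 2 * j else Suc (2 * j))"
    using Suc.prems assms(2) by (auto simp: swap_position_def j_def)
  have "pi_map a x ! (2 * i + 1) = x ! (swap_position a (2 * j) - 1)"
    "pi_map a x ! (2 * i + 2) = x ! (swap_position a (Suc (2 * j)) - 1)"
    using Suc.prems assms(1) by (auto simp: pi_map_nth j_def)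
  then show ?case
    using Suc unfolding * by (auto simp: height_Suc j_def)
qed

lemma height_pi_map_total:
  assumes "length x = 2 * n" "length a + 1 = n"
  shows "height (pi_map a x) (2 * n) = height x (2 * n)"
proof -
  obtain i where n: "n = Suc i" using assms(2) by (cases n) auto
  \<comment> \<open>Position \<open>2 * n\<close> would belong to pair number \<open>n\<close>,
    which lies beyond \<open>length a\<close>.\<close>
  have "swap_position a (2 * Suc i) = 2 * Suc i"
    using assms(2) n by (simp add: swap_position_def)
  then have "pi_map a x ! (2 * i + 1) = x ! (2 * i + 1)"
    using assms n by (simp add: pi_map_nth)
  then show ?thesis
    using height_pi_map_odd[OF assms, of i] n by (simp add: height_Suc)
qed

text \<open>\<open>once\<close> covers nonnegative paths and paths that dip once. A negative height
  at an even index would be at most -2 and pull its neighbours below 0; so negative heights occur at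
  odd indices only, where the swaps have no effect.\<close>

lemma pi_map_negative_heights:
  assumes "length x = 2 * n" "length a + 1 = n" "total x = 0"
    and once: "\<And>i j. i \<le> 2 * n \<Longrightarrow> j \<le> 2 * n \<Longrightarrow> height x i < 0 \<Longrightarrow> height x j < 0 \<Longrightarrow> i = j"
    and "i \<le> 2 * n"
  shows "height (pi_map a x) i < 0 \<longleftrightarrow> height x i < 0"
proof -
  let ?y = "pi_map a x"
  consider j where "i = 2 * j + 1" "j < n" | "i = 0" | "i = 2 * n" | j where "i = 2 * j" "0 < j" "j < n"
  proof (cases "even i")
    case True
    then obtain b where "i = 2 * b" by (auto elim: evenE)
    then show thesis using that(2,3) that(4)[of b] assms(5) by (cases "b = 0"; cases "b = n") auto
  next
    case False
    then show thesis using that(1) assms(5) by (auto elim: oddE)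
  qed
  then show ?thesis
  proof cases
    case (4 j)
    have step: "\<bar>height z (Suc l) - height z l\<bar> = 1" for z l by (simp add: height_Suc)
    have b: "2 * j - 1 \<le> 2 * n" "2 * j \<le> 2 * n" "2 * j + 1 \<le> 2 * n" "2 * j - 1 \<noteq> 2 * j"
      "2 * j - 1 \<noteq> 2 * j + 1"
      using 4 by auto
    have odd: "height ?y (2 * j - 1) = height x (2 * j - 1)" "height ?y (2 * j + 1) = height x (2 * j + 1)"
      using height_pi_map_odd[OF assms(1,2), of "j - 1"] height_pi_map_odd[OF assms(1,2), of j] 4
      by (auto simp: algebra_simps Suc_diff_Suc numeral_2_eq_2)
    have dist: "\<bar>height z (2 * j) - height z (2 * j - 1)\<bar> = 1" "\<bar>height z (2 * j + 1) - height z (2 * j)\<bar> = 1" for z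
      using step[of z "2 * j - 1"] step[of z "2 * j"] 4 by auto
    have par: "even (height x (2 * j))" "odd (height x (2 * j - 1))" "odd (height x (2 * j + 1))"
      using 4 by (auto simp: even_height)
    have "0 \<le> height x (2 * j)"
    proof (rule ccontr)
      assume *: "\<not> ?thesis"
      then have "height x (2 * j) \<noteq> - 1" using par by auto
      then have "height x (2 * j - 1) < 0" using dist(1)[of x] * by linarith
      then show False using once[of "2 * j - 1" "2 * j"] * b by (metis not_less)
    qed
    \<comment> \<open>At most one of the two odd neighbours is negative, so one of them has height
      at least 1 in \<open>x\<close> and in \<open>?y\<close>, and a single step from it cannot go
      below 0.\<close>
    moreover have "0 \<le> height ?y (2 * j)"
    proof (cases "height x (2 * j - 1) < 0")
      case True
      then have "\<not> height x (2 * j + 1) < 0"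
        using once[of "2 * j - 1" "2 * j + 1"] b by metis
      then have "1 \<le> height x (2 * j + 1)" using par(3) by (cases "height x (2 * j + 1) = 0") auto
      then show ?thesis using dist(2)[of ?y] odd by linarith
    next
      case False
      then have "1 \<le> height x (2 * j - 1)" using par(2) by (cases "height x (2 * j - 1) = 0") auto
      then show ?thesis using dist(1)[of ?y] odd by linarith
    qed
    ultimately show ?thesis using 4 by simp
  qed (use height_pi_map_odd[OF assms(1,2)] height_pi_map_total[OF assms(1,2)] in auto)
qed

text \<open>Reading backwards with negated steps gives
  \<open>height y (length y - i) - total y\<close>.\<close>

lemma height_complement_rev:
  assumes "total y = 0" "i \<le> length y"
  shows "height (map Not (rev y)) i = height y (length y - i)"
  using assms(2)
proof (induction i)
  case (Suc i)
  have "Suc (length y - Suc i) = length y - i" using Suc.prems by simp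
  then have "height y (length y - i)
      = height y (length y - Suc i) + (if y ! (length y - Suc i) then 1 else - 1)"
    by (metis height_Suc)
  then show ?case using Suc by (simp add: height_Suc rev_nth)
qed (simp add: assms(1))

lemma f_map_negative_heights:
  assumes "x \<in> layer (2 * n) n" "length a + 1 = n"
    and "\<And>i j. i \<le> 2 * n \<Longrightarrow> j \<le> 2 * n \<Longrightarrow> height x i < 0 \<Longrightarrow> height x j < 0 \<Longrightarrow> i = j"
    and "i \<le> 2 * n"
  shows "height (f_map a x) i < 0 \<longleftrightarrow> height x (2 * n - i) < 0"
proof -
  have len: "length x = 2 * n" and t: "total x = 0"
    using assms(1) layer_total[OF assms(1)] by (auto simp: layer_def)
  have "height (f_map a x) i = height (pi_map a x) (2 * n - i)"
    unfolding f_map_def using height_complement_rev[of "pi_map a x" i]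
      height_pi_map_total[OF len assms(2)] len t assms(4) by simp
  then show ?thesis
    using pi_map_negative_heights[OF len assms(2) t assms(3), of "2 * n - i"] by simp
qed

lemma f_map_in_middle:
  assumes "x \<in> layer (2 * n) n" "length a + 1 = n"
  shows "f_map a x \<in> layer (2 * n) n"
  using f_map_layer[OF assms(2), of n] assms(1) by fastforce

text \<open>On a finite set, inclusion and injectivity already give equality.\<close>

lemma f_map_touching:
  assumes "length a + 1 = n"
  shows "f_map a ` touching (2 * n) n = touching (2 * n) n"
proof (rule endo_inj_surj)
  have n: "1 \<le> n" using assms by simp
  have "nonneg_path (f_map a x)" if "x \<in> layer (2 * n) n" "nonneg_path x" for x
    using f_map_negative_heights[OF that(1) assms] that
    by (auto simp: nonneg_path_def layer_def not_less[symmetric])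
  then show "f_map a ` touching (2 * n) n \<subseteq> touching (2 * n) n"
    using f_map_in_middle[OF _ assms] by (auto simp: touching_middle[OF n])
  show "finite (touching (2 * n) n)" "inj_on (f_map a) (touching (2 * n) n)"
    using finite_bits_length[of "2 * n"] inj_on_f_map[OF assms]
    by (auto simp: touching_def layer_def elim!: finite_subset[rotated] inj_on_subset)
qed

lemma f_map_dipping:
  assumes "length a + 1 = n"
  shows "f_map a ` dipping (2 * n) n = dipping (2 * n) n"
proof (rule endo_inj_surj)
  have "dips_once (f_map a x)" if xl: "x \<in> layer (2 * n) n" and dip: "dips_once x" for x
  proof -
    have len: "length x = 2 * n" using xl by (simp add: layer_def)
    obtain i where i: "i \<le> 2 * n" "height x i < 0" "\<And>j. j \<le> 2 * n \<Longrightarrow> height x j < 0 \<Longrightarrow> j = i"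
      using dip len unfolding dips_once_def by (elim ex1E) auto
    then have *: "height (f_map a x) j < 0 \<longleftrightarrow> height x (2 * n - j) < 0" if "j \<le> 2 * n" for j
      using f_map_negative_heights[OF xl assms _ that] i(3) by blast
    show ?thesis
      unfolding dips_once_def
    \<comment> \<open>The witness is the mirror image of the single dip \<open>i\<close> of
      \<open>x\<close>.\<close>
    proof (rule ex1I[of _ "2 * n - i"])
      show "2 * n - i \<le> length (f_map a x) \<and> height (f_map a x) (2 * n - i) < 0"
        using i(1,2) *[of "2 * n - i"] len by simp
      fix j assume "j \<le> length (f_map a x) \<and> height (f_map a x) j < 0"
      then have "j \<le> 2 * n" "2 * n - j = i" using * i(3)[of "2 * n - j"] len by auto
      then show "j = 2 * n - i" by simp
    qed
  qed
  then show "f_map a ` dipping (2 * n) n \<subseteq> dipping (2 * n) n"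
    using f_map_in_middle[OF _ assms] by (auto simp: dipping_def)
  show "finite (dipping (2 * n) n)" "inj_on (f_map a) (dipping (2 * n) n)"
    using finite_bits_length[of "2 * n"] inj_on_f_map[OF assms]
    by (auto simp: dipping_def layer_def elim!: finite_subset[rotated] inj_on_subset)
qed


section \<open>Families of paths between two layers\<close>

text \<open>Equal length is included so that the relation may be reversed: \<open>hamming\<close>
  bounds the index by its first argument only.\<close>

definition unit_steps :: "(bits \<times> bits) set \<Rightarrow> bool" where
  "unit_steps A \<longleftrightarrow> (\<forall>(u, v)\<in>A. length u = length v \<and> hamming u v = 1)"

text \<open>The invariant of the construction, valid for all \<open>k \<ge> n\<close> with \<open>m = 2 * n\<close>.
  Since \<open>positive (2 * n) n = {}\<close>, it covers both (i) and (ii).\<close>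

definition cube_family :: "nat \<Rightarrow> nat \<Rightarrow> bits opath set \<Rightarrow> bool" where
  "cube_family m k P \<longleftrightarrow> disjoint_paths P \<and> unit_steps (\<Union>p\<in>P. arcs_path p)
    \<and> visited P = layer m (Suc k) \<union> (layer m k - positive m k)
    \<and> first_v ` P = touching m k \<and> second_v ` P = positive m (Suc k) \<and> last_v ` P = dipping m k"

lemma unit_steps_Un: "unit_steps (A \<union> B) \<longleftrightarrow> unit_steps A \<and> unit_steps B"
  by (auto simp: unit_steps_def)

lemma unit_steps_converse: "unit_steps A \<Longrightarrow> unit_steps (A\<inverse>)"
  by (auto simp: unit_steps_def hamming_commute)

lemma unit_steps_append: "unit_steps A \<Longrightarrow> unit_steps (map_prod (\<lambda>x. x @ z) (\<lambda>x. x @ z) ` A)"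
  by (fastforce simp: unit_steps_def hamming_append)

lemma UN_arcs_map:
  "(\<Union>p\<in>map g ` P. arcs_path p) = map_prod g g ` (\<Union>p\<in>P. arcs_path p)"
  by (simp add: arcs_path_map image_UN)

lemma append_family:
  assumes "disjoint_paths P"
  shows "disjoint_paths (append_family P z)"
    and "visited (append_family P z) = (\<lambda>x. x @ z) ` visited P"
    and "first_v ` append_family P z = (\<lambda>x. x @ z) ` first_v ` P"
    and "second_v ` append_family P z = (\<lambda>x. x @ z) ` second_v ` P"
    and "last_v ` append_family P z = (\<lambda>x. x @ z) ` last_v ` P"
    and "(\<Union>p\<in>append_family P z. arcs_path p)
      = map_prod (\<lambda>x. x @ z) (\<lambda>x. x @ z) ` (\<Union>p\<in>P. arcs_path p)"
proof -
  have *: "append_family P z = map (\<lambda>x. x @ z) ` P"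
    by (simp add: append_family_def)
  show "disjoint_paths (append_family P z)"
    unfolding * by (intro disjoint_paths_map assms) (simp add: inj_on_def)
qed (simp_all only: append_family_def visited_map endpoints_map[OF assms] UN_arcs_map)

lemma cube_layers_edgeI:
  assumes "x \<in> layer m k \<union> layer m (k + 1)" "y \<in> layer m k \<union> layer m (k + 1)" "hamming x y = 1"
  shows "{x, y} \<in> edges (cube_layers m k)"
proof -
  have "length x = m" using assms(1) by (auto simp: layer_def)
  then show ?thesis
    using assms unfolding cube_layers_def Let_def hamming_def by auto
qed

lemma verts_cube_layers: "verts (cube_layers m k) = layer m k \<union> layer m (k + 1)"
  by (simp add: cube_layers_def Let_def)

lemma cube_family_opath_in:
  assumes "cube_family m k P" "p \<in> P"
  shows "opath_in (cube_layers m k) p"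
proof -
  have sub: "set p \<subseteq> layer m k \<union> layer m (k + 1)"
    using assms by (auto simp: cube_family_def visited_def)
  have "edges (path_graph p) \<subseteq> edges (cube_layers m k)"
  proof
    fix e assume "e \<in> edges (path_graph p)"
    then obtain u v where uv: "(u, v) \<in> arcs_path p" "e = {u, v}"
      unfolding edges_path_graph by (rule uedgesE)
    then have "u \<in> set p" "v \<in> set p"
      using arcs_path_subset[of p] by auto
    moreover have "hamming u v = 1"
      using assms uv unfolding cube_family_def unit_steps_def by blast
    ultimately show "e \<in> edges (cube_layers m k)"
      unfolding uv(2) using sub by (intro cube_layers_edgeI) auto
  qed
  then show ?thesis
    using sub assms by (auto simp: opath_in_def subgraph_def verts_cube_layers cube_family_def disjoint_pathsD)
qed

text \<open>Lets every equation between vertex classes be checked suffix by suffix, in four cases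
  for the last two bits.\<close>

lemma bits_snoc2_eqI:
  assumes "\<And>y. y \<in> A \<union> B \<Longrightarrow> 2 \<le> length y" "\<And>x a b. x @ [a, b] \<in> A \<longleftrightarrow> x @ [a, b] \<in> B"
  shows "A = B"
proof -
  have "\<exists>x a b. y = x @ [a, b]" if "2 \<le> length y" for y :: "'a list"
  proof -
    have "y = take (length y - 2) y @ [y ! (length y - 2), y ! (length y - 1)]"
      using that by (intro nth_equalityI) (auto simp: nth_append nth_Cons' intro: arg_cong[where f = "nth y"])
    then show ?thesis by blast
  qed
  then show ?thesis using assms by blast
qed

lemma snoc2_in_image: "x @ [a, b] \<in> (\<lambda>x. x @ [c, d]) ` S \<longleftrightarrow> x \<in> S \<and> a = c \<and> b = d"
  by auto

lemma length_classes:
  "x \<in> layer m k \<Longrightarrow> length x = m" "x \<in> positive m k \<Longrightarrow> length x = m"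
  "x \<in> touching m k \<Longrightarrow> length x = m" "x \<in> dipping m k \<Longrightarrow> length x = m"
  by (auto simp: layer_def positive_def touching_def dipping_def)

text \<open>With \<open>k = j + 2\<close>, the last two bits split each class at level
  \<open>k\<close> into the same class at levels \<open>k\<close>, \<open>k - 1\<close>,
  \<open>k - 1\<close> and \<open>k - 2\<close>, which is the pattern of the four families.\<close>

lemma cube_family_step_high:
  assumes "1 \<le> n" "n \<le> j" and A: "cube_family (2 * n) (Suc (Suc j)) A"
    and B: "cube_family (2 * n) (Suc j) B" and C: "cube_family (2 * n) j C"
  shows "cube_family (2 * Suc n) (Suc (Suc j))
    (append_family A [False, False] \<union> append_family B [True, False]
      \<union> append_family B [False, True] \<union> append_family C [True, True])"
    (is "cube_family _ _ ?F")
proof -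
  have dA: "disjoint_paths A" and dB: "disjoint_paths B" and dC: "disjoint_paths C"
    using A B C by (auto simp: cube_family_def)
  note app = append_family[OF dA] append_family[OF dB] append_family[OF dC]
  \<comment> \<open>Second vertices and the upper layer lie one level higher, hence the second
    instance.\<close>
  note cl = classes_snoc2[OF assms(1), of "Suc (Suc j)"] classes_snoc2[OF assms(1), of "Suc (Suc (Suc j))"]
  have "disjoint_paths ?F"
    by (intro disjoint_paths_Un) (auto simp: app visited_Un)
  moreover have "unit_steps (\<Union>p\<in>?F. arcs_path p)"
    using A B C by (auto simp: UN_Un app unit_steps_Un cube_family_def intro!: unit_steps_append)
  moreover have "visited ?F = layer (2 * Suc n) (Suc (Suc (Suc j)))
      \<union> (layer (2 * Suc n) (Suc (Suc j)) - positive (2 * Suc n) (Suc (Suc j)))"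
  proof (rule bits_snoc2_eqI)
    fix x a b
    show "x @ [a, b] \<in> visited ?F \<longleftrightarrow> x @ [a, b] \<in> layer (2 * Suc n) (Suc (Suc (Suc j)))
      \<union> (layer (2 * Suc n) (Suc (Suc j)) - positive (2 * Suc n) (Suc (Suc j)))"
      unfolding visited_Un app Un_iff Diff_iff snoc2_in_image
      using A B C assms(2) by (cases a; cases b) (simp_all add: cl cube_family_def del: mult_Suc_right)
  qed (use A B C in \<open>auto simp: visited_Un app cube_family_def dest: length_classes\<close>)
  moreover have "first_v ` ?F = touching (2 * Suc n) (Suc (Suc j))"
  proof (rule bits_snoc2_eqI)
    fix x a b
    show "x @ [a, b] \<in> first_v ` ?F \<longleftrightarrow> x @ [a, b] \<in> touching (2 * Suc n) (Suc (Suc j))"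
      unfolding image_Un app Un_iff snoc2_in_image
      using A B C assms(2) by (cases a; cases b) (simp_all add: cl cube_family_def del: mult_Suc_right)
  qed (use A B C in \<open>auto simp: image_Un app cube_family_def dest: length_classes\<close>)
  moreover have "second_v ` ?F = positive (2 * Suc n) (Suc (Suc (Suc j)))"
  proof (rule bits_snoc2_eqI)
    fix x a b
    show "x @ [a, b] \<in> second_v ` ?F \<longleftrightarrow> x @ [a, b] \<in> positive (2 * Suc n) (Suc (Suc (Suc j)))"
      unfolding image_Un app Un_iff snoc2_in_image
      using A B C assms(2) by (cases a; cases b) (simp_all add: cl cube_family_def del: mult_Suc_right)
  qed (use A B C in \<open>auto simp: image_Un app cube_family_def dest: length_classes\<close>)
  moreover have "last_v ` ?F = dipping (2 * Suc n) (Suc (Suc j))"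
  proof (rule bits_snoc2_eqI)
    fix x a b
    show "x @ [a, b] \<in> last_v ` ?F \<longleftrightarrow> x @ [a, b] \<in> dipping (2 * Suc n) (Suc (Suc j))"
      unfolding image_Un app Un_iff snoc2_in_image
      using A B C assms(2) by (cases a; cases b) (simp_all add: cl cube_family_def del: mult_Suc_right)
  qed (use A B C in \<open>auto simp: image_Un app cube_family_def dest: length_classes\<close>)
  ultimately show ?thesis
    unfolding cube_family_def by blast
qed

text \<open>\<open>E\<close> stands for P'. With suffix 00 the family \<open>A\<close> leaves out
  exactly the positive vertices of layer \<open>n + 1\<close>, and these are the starts of the paths
  in \<open>E\<close>; suffix 10 is covered by \<open>B\<close>, suffixes 01 and 11 by
  \<open>E\<close>.\<close>

lemma cube_family_step_middle:
  assumes n: "1 \<le> n" and A: "cube_family (2 * n) (Suc n) A" and B: "cube_family (2 * n) n B"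
    and E: "disjoint_paths E" "unit_steps (\<Union>p\<in>E. arcs_path p)"
    and visE: "visited E = (\<lambda>x. x @ [False, False]) ` positive (2 * n) (Suc n)
      \<union> (\<lambda>x. x @ [False, True]) ` (layer (2 * n) (Suc n) \<union> layer (2 * n) n)
      \<union> (\<lambda>x. x @ [True, True]) ` (layer (2 * n) n \<union> layer (2 * n) (n - 1))"
    and firstE: "first_v ` E = (\<lambda>x. x @ [False, False]) ` positive (2 * n) (Suc n)"
    and secondE: "second_v ` E = (\<lambda>x. x @ [False, True]) ` positive (2 * n) (Suc n)"
    and lastE: "last_v ` E = (\<lambda>x. x @ [False, True]) ` touching (2 * n) n"
  shows "cube_family (2 * Suc n) (Suc n)
    (append_family A [False, False] \<union> append_family B [True, False] \<union> E)"
    (is "cube_family _ _ ?F")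
proof -
  have dA: "disjoint_paths A" and dB: "disjoint_paths B"
    using A B by (auto simp: cube_family_def)
  note app = append_family[OF dA] append_family[OF dB]
  have pos: "positive (2 * n) (Suc n) \<subseteq> layer (2 * n) (Suc n)" by (auto simp: positive_def)
  have visA: "visited A = layer (2 * n) (Suc (Suc n)) \<union> (layer (2 * n) (Suc n) - positive (2 * n) (Suc n))"
    and visB: "visited B = layer (2 * n) (Suc n) \<union> layer (2 * n) n"
    using A B positive_middle[OF n] by (auto simp: cube_family_def)
  have disj: "visited A \<inter> positive (2 * n) (Suc n) = {}"
    unfolding visA using pos by (auto simp: layer_def)
  have lay: "x @ [a, b] \<in> layer (2 * Suc n) k \<longleftrightarrow>
      x \<in> layer (2 * n) (k - of_bool a - of_bool b)" if "2 \<le> k" for x a b k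
    using that unfolding layer_snoc2 by (auto simp: layer_def)
  have "disjoint_paths ?F"
  proof (intro disjoint_paths_Un)
    show "visited (append_family A [False, False] \<union> append_family B [True, False]) \<inter> visited E = {}"
      unfolding visited_Un app visE visB using disj by auto
  qed (use E in \<open>auto simp: app\<close>)
  moreover have "unit_steps (\<Union>p\<in>?F. arcs_path p)"
    using A B E by (auto simp: UN_Un app unit_steps_Un cube_family_def intro!: unit_steps_append)
  moreover have "visited ?F = layer (2 * Suc n) (Suc (Suc n))
      \<union> (layer (2 * Suc n) (Suc n) - positive (2 * Suc n) (Suc n))"
  proof (rule bits_snoc2_eqI)
    fix x a b
    have "positive (2 * Suc n) (Suc n) = {}" by (rule positive_middle) simp
    then show "x @ [a, b] \<in> visited ?F \<longleftrightarrow> x @ [a, b] \<in> layer (2 * Suc n) (Suc (Suc n))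
      \<union> (layer (2 * Suc n) (Suc n) - positive (2 * Suc n) (Suc n))"
      unfolding visited_Un app Un_iff snoc2_in_image visA visB visE
      using pos n by (cases a; cases b) (auto simp add: lay simp del: mult_Suc_right)
  qed (auto simp: visited_Un app visA visB visE dest: length_classes)
  moreover have "first_v ` ?F = touching (2 * Suc n) (Suc n)"
  proof (rule bits_snoc2_eqI)
    fix x a b
    show "x @ [a, b] \<in> first_v ` ?F \<longleftrightarrow> x @ [a, b] \<in> touching (2 * Suc n) (Suc n)"
      unfolding image_Un app Un_iff snoc2_in_image firstE
      using A B
      by (cases a; cases b) (simp_all add: classes_snoc2_middle[OF n] cube_family_def del: mult_Suc_right)
  qed (use A B in \<open>auto simp: image_Un app firstE cube_family_def dest: length_classes\<close>)
  moreover have "second_v ` ?F = positive (2 * Suc n) (Suc (Suc n))"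
  proof (rule bits_snoc2_eqI)
    fix x a b
    show "x @ [a, b] \<in> second_v ` ?F \<longleftrightarrow> x @ [a, b] \<in> positive (2 * Suc n) (Suc (Suc n))"
      unfolding image_Un app Un_iff snoc2_in_image secondE
      using A B positive_middle[OF n]
      by (cases a; cases b) (simp_all add: classes_snoc2[OF n] cube_family_def del: mult_Suc_right)
  qed (use A B in \<open>auto simp: image_Un app secondE cube_family_def dest: length_classes\<close>)
  moreover have "last_v ` ?F = dipping (2 * Suc n) (Suc n)"
  proof (rule bits_snoc2_eqI)
    fix x a b
    show "x @ [a, b] \<in> last_v ` ?F \<longleftrightarrow> x @ [a, b] \<in> dipping (2 * Suc n) (Suc n)"
      unfolding image_Un app Un_iff snoc2_in_image lastE
      using A B
      by (cases a; cases b) (simp_all add: classes_snoc2_middle[OF n] cube_family_def del: mult_Suc_right)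
  qed (use A B in \<open>auto simp: image_Un app lastE cube_family_def dest: length_classes\<close>)
  ultimately show ?thesis
    unfolding cube_family_def by blast
qed

lemma layer_above: "m < k \<Longrightarrow> layer m k = {}"
  using count_le_length[of _ True] by (auto simp: layer_def) (meson leD)

text \<open>For \<open>k = m\<close> the only string is all ones, a positive path, so there is
  nothing to visit; for larger \<open>k\<close> the layers are empty. This lets the invariant run
  over all \<open>k \<ge> n\<close> without boundary cases.\<close>

lemma cube_family_empty:
  assumes "1 \<le> m" "m \<le> k"
  shows "cube_family m k {}"
proof -
  have "pos_path x" if "x \<in> layer m k" for x
  proof -
    have "count_list x True = length x"
      using that assms count_le_length[of x True] by (auto simp: layer_def)
    then have "pos_path x"
    proof (induction x rule: rev_induct)
      case (snoc b x)
      have b: "b" "count_list x True = length x"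
        using snoc.prems count_le_length[of x True] by (auto split: if_splits)
      moreover have "0 \<le> total x" using b total_count[of x] by simp
      ultimately show ?case using snoc.IH by (simp add: pos_path_snoc total_snoc del: length_append)
    qed (simp add: pos_path_def)
    then show ?thesis .
  qed
  then have "layer m k \<subseteq> positive m k" "touching m k = {}" "dipping m k = {}"
    using pos_imp_nonneg by (auto simp: positive_def touching_def dipping_def dips_once_def nonneg_path_def not_less[symmetric])
  moreover have "layer m (Suc k) = {}" using assms by (intro layer_above) simp
  moreover from this have "positive m (Suc k) = {}" by (auto simp: positive_def)
  ultimately show ?thesis
    by (auto simp: cube_family_def disjoint_paths_def unit_steps_def visited_def)
qed

lemma cube_family_base:
  "cube_family 2 1 {[[True, False], [True, True], [False, True]]}" (is "cube_family _ _ ?P")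
proof -
  have layers: "x @ [a, b] \<in> layer 2 k \<longleftrightarrow> x = [] \<and> of_bool a + of_bool b = k" for x a b k
    using layer_snoc2[of x a b 0 k] by (cases "x = []") (simp_all add: layer_def)
  have tot: "total [a] = (if a then 1 else - 1)" "total [a, b] = (if a then 1 else - 1) + (if b then 1 else - 1)" for a b
    using total_snoc[of "[]" a] total_snoc[of "[a]" b] by auto
  have Nil: "nonneg_path []" "pos_path []" "\<not> dips_once []"
    by (auto simp: nonneg_path_def pos_path_def dips_once_def)
  note cls = touching_def positive_def dipping_def
  have mem: "x @ [a, b] \<in> touching 2 1 \<longleftrightarrow> x = [] \<and> a \<and> \<not> b"
    "x @ [a, b] \<in> dipping 2 1 \<longleftrightarrow> x = [] \<and> \<not> a \<and> b"
    "x @ [a, b] \<in> positive 2 (Suc 1) \<longleftrightarrow> x = [] \<and> a \<and> b"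
    "x @ [a, b] \<notin> positive 2 1" for x a b
    unfolding cls mem_Collect_eq layers path_snoc2
    using tot Nil by (cases a; cases b; auto)+
  have "disjoint_paths ?P" by (simp add: disjoint_paths_def is_opath_def)
  moreover have "unit_steps (\<Union>p\<in>?P. arcs_path p)"
    using hamming_bit[of False True "[True]" "[]"] hamming_bit[of True False "[]" "[True]"]
    by (simp add: unit_steps_def)
  moreover have "visited ?P = layer 2 (Suc 1) \<union> (layer 2 1 - positive 2 1)"
  proof (rule bits_snoc2_eqI)
    show "x @ [a, b] \<in> visited ?P \<longleftrightarrow> x @ [a, b] \<in> layer 2 (Suc 1) \<union> (layer 2 1 - positive 2 1)" for x a b
      unfolding Un_iff Diff_iff layers using mem(4) by (cases a; cases b) (auto simp: visited_def)
  qed (auto simp: visited_def dest: length_classes)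
  moreover have "first_v ` ?P = touching 2 1"
    and "last_v ` ?P = dipping 2 1" and "second_v ` ?P = positive 2 (Suc 1)"
    by (rule bits_snoc2_eqI; (unfold mem)?; auto simp: first_v_def last_v_def second_v_def dest: length_classes)+
  ultimately show ?thesis
    unfolding cube_family_def by blast
qed


section \<open>From the middle layers of one cube to the next\<close>

text \<open>An edge could survive the deletion of its arc only through the opposite arc.\<close>

lemma uedges_diff:
  assumes "\<And>u v. (u, v) \<in> D \<Longrightarrow> (v, u) \<notin> D" "A \<subseteq> D"
  shows "uedges D - uedges A = uedges (D - A)"
proof
  show "uedges D - uedges A \<subseteq> uedges (D - A)"
    by (auto simp: uedges_def)
  show "uedges (D - A) \<subseteq> uedges D - uedges A"
  proof
    fix e assume "e \<in> uedges (D - A)"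
    then obtain u v where uv: "(u, v) \<in> D" "(u, v) \<notin> A" "e = {u, v}"
      by (auto elim: uedgesE)
    moreover have "(v, u) \<notin> A" using assms uv(1) by blast
    ultimately show "e \<in> uedges D - uedges A"
      by (simp add: uedges_pair_iff)
  qed
qed

text \<open>One step of the construction: \<open>P\<close> is the middle family for
  \<open>n\<close>, and \<open>a\<close> is the parameter used with it. The form
  \<open>length a + 1 = n\<close> also makes \<open>n\<close> positive.\<close>

locale middle_family =
  fixes n :: nat and a :: bits and P :: "bits opath set"
  assumes length_a: "length a + 1 = n" and family: "cube_family (2 * n) n P"
begin

abbreviation f :: "bits \<Rightarrow> bits" where
  "f \<equiv> f_map a"

lemma n_pos: "1 \<le> n"
  using length_a by simp

lemma disjoint_P: "disjoint_paths P"
  and visited_P: "visited P = layer (2 * n) (Suc n) \<union> layer (2 * n) n"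
  and first_P: "first_v ` P = touching (2 * n) n"
  and second_P: "second_v ` P = positive (2 * n) (Suc n)"
  and last_P: "last_v ` P = dipping (2 * n) n"
  using family positive_middle[OF n_pos] by (auto simp: cube_family_def)

lemma length_visited: "x \<in> visited P \<Longrightarrow> length x = 2 * n"
  unfolding visited_P by (auto simp: layer_def)

lemma inj_f: "inj_on f (visited P)"
  using inj_on_f_map[OF length_a] length_visited by (auto intro: inj_on_subset)

lemma f_visited: "f ` visited P = layer (2 * n) n \<union> layer (2 * n) (n - 1)"
proof -
  have "2 * n - n = n" "2 * n - Suc n = n - 1" by auto
  then show ?thesis
    using n_pos by (simp add: visited_P image_Un f_map_layer[OF length_a] Un_commute)
qed

lemma disjoint_f: "disjoint_paths (map f ` P)"
  by (rule disjoint_paths_map[OF disjoint_P inj_f])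

lemma first_f: "first_v ` map f ` P = touching (2 * n) n"
  and last_f: "last_v ` map f ` P = dipping (2 * n) n"
  by (simp_all add: endpoints_map[OF disjoint_P] first_P last_P
      f_map_touching[OF length_a] f_map_dipping[OF length_a])

lemma endpoints_subset:
  "touching (2 * n) n \<subseteq> visited P" "dipping (2 * n) n \<subseteq> visited P"
  "touching (2 * n) n \<subseteq> f ` visited P" "dipping (2 * n) n \<subseteq> f ` visited P"
  unfolding f_visited unfolding visited_P by (auto simp: touching_def dipping_def)

section \<open>The 2-factor as a relation of arcs\<close>

definition arcs_P :: "(bits \<times> bits) set" where
  "arcs_P = (\<Union>p\<in>P. arcs_path p)"

definition arcs_fP :: "(bits \<times> bits) set" where
  "arcs_fP = (\<Union>p\<in>map f ` P. arcs_path p)"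

lemma single_valued_arcs:
  "single_valued arcs_P" "single_valued (arcs_P\<inverse>)"
  "single_valued arcs_fP" "single_valued (arcs_fP\<inverse>)"
  unfolding arcs_P_def arcs_fP_def
  by (intro single_valued_UN_arcs disjoint_P disjoint_f)+

lemma arcs_Domain_Range:
  "Domain arcs_P = visited P - dipping (2 * n) n" "Range arcs_P = visited P - touching (2 * n) n"
  "Domain arcs_fP = f ` visited P - dipping (2 * n) n" "Range arcs_fP = f ` visited P - touching (2 * n) n"
  unfolding arcs_P_def arcs_fP_def Domain_UN_arcs[OF disjoint_P] Range_UN_arcs[OF disjoint_P]
    Domain_UN_arcs[OF disjoint_f] Range_UN_arcs[OF disjoint_f] first_P last_P first_f last_f visited_map
  by (rule refl)+

lemma arcs_antisym: "(x, y) \<in> arcs_P \<Longrightarrow> (y, x) \<notin> arcs_P" "(x, y) \<in> arcs_fP \<Longrightarrow> (y, x) \<notin> arcs_fP"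
  unfolding arcs_P_def arcs_fP_def
  by (erule UN_arcs_antisym[OF disjoint_P] UN_arcs_antisym[OF disjoint_f])+

lemma arcs_fP_eq: "arcs_fP = map_prod f f ` arcs_P"
  unfolding arcs_P_def arcs_fP_def UN_arcs_map ..

text \<open>The 2-factor, with the paths \<open>P \<circ> (0)\<close> traversed forwards and the paths
  \<open>f(P) \<circ> (1)\<close> backwards. This is consistent because \<open>f\<close> permutes the first vertices
  and permutes the last vertices of the paths.\<close>

definition directed :: "(bits \<times> bits) set" where
  "directed = map_prod (\<lambda>x. x @ [False]) (\<lambda>x. x @ [False]) ` arcs_P
    \<union> map_prod (\<lambda>x. x @ [True]) (\<lambda>x. x @ [True]) ` arcs_fP\<inverse>
    \<union> (\<lambda>v. (v @ [False], v @ [True])) ` dipping (2 * n) n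
    \<union> (\<lambda>v. (v @ [True], v @ [False])) ` touching (2 * n) n"

lemma snoc_in_map_prod:
  "(x @ [b], y @ [c]) \<in> map_prod (\<lambda>x. x @ [d]) (\<lambda>x. x @ [d]) ` A \<longleftrightarrow> b = d \<and> c = d \<and> (x, y) \<in> A"
  by (auto intro: rev_image_eqI)

lemma directed_snoc:
  "(x @ [False], y @ [False]) \<in> directed \<longleftrightarrow> (x, y) \<in> arcs_P"
  "(x @ [True], y @ [True]) \<in> directed \<longleftrightarrow> (y, x) \<in> arcs_fP"
  "(x @ [False], y @ [True]) \<in> directed \<longleftrightarrow> x = y \<and> x \<in> dipping (2 * n) n"
  "(x @ [True], y @ [False]) \<in> directed \<longleftrightarrow> x = y \<and> x \<in> touching (2 * n) n"
  unfolding directed_def Un_iff snoc_in_map_prod by auto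

lemma directed_cases:
  assumes "(u, v) \<in> directed"
  obtains x y b c where "u = x @ [b]" "v = y @ [c]"
  using assms unfolding directed_def by auto

text \<open>A vertex ending in 0 leaves along \<open>P\<close> unless it is a last vertex, and then
  only by its matching arc; one ending in 1 leaves along a reversed image path unless it is the
  first vertex of one. Entering arcs behave alike.\<close>

lemma single_valued_directed: "single_valued directed" "single_valued (directed\<inverse>)"
proof -
  note sv = single_valued_arcs
  have dom: "x \<notin> dipping (2 * n) n" if "(x, y) \<in> arcs_P" for x y
    using arcs_Domain_Range that by blast
  have ran: "y \<notin> touching (2 * n) n" if "(x, y) \<in> arcs_P" for x y
    using arcs_Domain_Range that by blast
  have domf: "x \<notin> dipping (2 * n) n" if "(x, y) \<in> arcs_fP" for x y
    using arcs_Domain_Range that by blast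
  have ranf: "y \<notin> touching (2 * n) n" if "(x, y) \<in> arcs_fP" for x y
    using arcs_Domain_Range that by blast
  show "single_valued directed"
  proof (rule single_valuedI)
    fix u v w assume *: "(u, v) \<in> directed" "(u, w) \<in> directed"
    then obtain x y z b c d where u: "u = x @ [b]" "v = y @ [c]" "w = z @ [d]"
      by (auto elim!: directed_cases)
    show "v = w"
      using * sv(1,4) dom ranf unfolding u
      by (cases b; cases c; cases d) (auto simp only: directed_snoc single_valued_def converse_iff)
  qed
  show "single_valued (directed\<inverse>)"
  proof (rule single_valuedI)
    fix u v w assume *: "(u, v) \<in> directed\<inverse>" "(u, w) \<in> directed\<inverse>"
    then obtain x y z b c d where u: "u = x @ [b]" "v = y @ [c]" "w = z @ [d]"
      by (auto elim!: directed_cases)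
    show "v = w"
      using * sv(2,3) ran domf unfolding u converse_iff
      by (cases b; cases c; cases d) (auto simp only: directed_snoc single_valued_def converse_iff)
  qed
qed

lemma directed_antisym:
  assumes "(u, v) \<in> directed"
  shows "(v, u) \<notin> directed"
proof -
  obtain x y b c where u: "u = x @ [b]" "v = y @ [c]"
    using assms by (rule directed_cases)
  show ?thesis
    using assms arcs_antisym(1)[of x y] arcs_antisym(2)[of y x]
      touching_not_dipping[of x "2 * n" n] unfolding u
    by (cases b; cases c) (auto simp only: directed_snoc)
qed

text \<open>The path arcs miss exactly the appropriate end vertices, and the matching arcs supply
  them, so every vertex has an outgoing and an incoming arc.\<close>

lemma directed_Domain_Range:
  "Domain directed = (\<lambda>x. x @ [False]) ` visited P \<union> (\<lambda>x. x @ [True]) ` f ` visited P"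
  "Range directed = (\<lambda>x. x @ [False]) ` visited P \<union> (\<lambda>x. x @ [True]) ` f ` visited P"
proof -
  have dom: "Domain (map_prod g g ` A) = g ` Domain A" for g :: "bits \<Rightarrow> bits" and A
    by force
  have ran: "Range (map_prod g g ` A) = g ` Range A" for g :: "bits \<Rightarrow> bits" and A
    by force
  have dom2: "Domain ((\<lambda>v. (g v, h v)) ` A) = g ` A" and ran2: "Range ((\<lambda>v. (g v, h v)) ` A) = h ` A"
    for g h :: "bits \<Rightarrow> bits" and A by force+
  have *: "A - B \<union> B = A" "B \<subseteq> A \<Longrightarrow> g ` (A - B) \<union> g ` B = g ` A" if "B \<subseteq> A" for A B :: "bits set" and g :: "bits \<Rightarrow> bits"
    using that by auto
  have "Domain directed = ((\<lambda>x. x @ [False]) ` (visited P - dipping (2 * n) n) \<union> (\<lambda>x. x @ [False]) ` dipping (2 * n) n)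
      \<union> ((\<lambda>x. x @ [True]) ` (f ` visited P - touching (2 * n) n) \<union> (\<lambda>x. x @ [True]) ` touching (2 * n) n)"
    unfolding directed_def Domain_Un_eq dom dom2 Domain_converse arcs_Domain_Range by blast
  then show "Domain directed = (\<lambda>x. x @ [False]) ` visited P \<union> (\<lambda>x. x @ [True]) ` f ` visited P"
    using endpoints_subset by (simp only: *)
  have "Range directed = ((\<lambda>x. x @ [False]) ` (visited P - touching (2 * n) n) \<union> (\<lambda>x. x @ [False]) ` touching (2 * n) n)
      \<union> ((\<lambda>x. x @ [True]) ` (f ` visited P - dipping (2 * n) n) \<union> (\<lambda>x. x @ [True]) ` dipping (2 * n) n)"
    unfolding directed_def Range_Un_eq ran ran2 Range_converse arcs_Domain_Range by blast
  then show "Range directed = (\<lambda>x. x @ [False]) ` visited P \<union> (\<lambda>x. x @ [True]) ` f ` visited P"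
    using endpoints_subset by (simp only: *)
qed

lemma steps_P: "unit_steps arcs_P"
  using family by (simp add: cube_family_def arcs_P_def)

lemma steps_f: "unit_steps arcs_fP"
proof -
  have "length (f u) = length (f v) \<and> hamming (f u) (f v) = 1" if "(u, v) \<in> arcs_P" for u v
  proof -
    have "u \<in> visited P" "v \<in> visited P"
      using that arcs_Domain_Range by blast+
    moreover have "hamming u v = 1"
      using that steps_P unfolding unit_steps_def by blast
    ultimately show ?thesis
      using hamming_f_map[OF length_a, of u v] length_visited by simp
  qed
  then show ?thesis
    unfolding arcs_fP_eq unit_steps_def by auto
qed

lemma steps_directed: "unit_steps directed"
  unfolding directed_def unit_steps_Un
  using unit_steps_append[OF steps_P] unit_steps_append[OF unit_steps_converse[OF steps_f]]
    hamming_bit[of True False _ "[]"] hamming_bit[of False True _ "[]"]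
  by (auto simp: unit_steps_def)

lemma verts_C_directed: "verts (C_graph a P) = Domain directed" "verts (C_graph a P) = Range directed"
proof -
  have "verts (C_graph a P) = (\<lambda>x. x @ [False]) ` visited P \<union> (\<lambda>x. x @ [True]) ` f ` visited P
      \<union> \<Union> (M_FL P)"
    by (simp add: C_graph_def graph_union_def family_graph_def graph_of_edges_def append_family_def visited_map)
  \<comment> \<open>The end vertices lie on paths in both copies already, so the matching adds no
    vertices.\<close>
  also have "\<dots> = (\<lambda>x. x @ [False]) ` visited P \<union> (\<lambda>x. x @ [True]) ` f ` visited P"
    using endpoints_subset unfolding M_FL_def first_P last_P by auto
  finally show "verts (C_graph a P) = Domain directed" "verts (C_graph a P) = Range directed"
    by (simp_all only: directed_Domain_Range)
qed

lemma verts_C: "verts (C_graph a P) = layer (2 * n + 1) n \<union> layer (2 * n + 1) (n + 1)"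
  unfolding verts_C_directed(1) directed_Domain_Range(1)
proof (rule set_eqI)
  fix y
  show "y \<in> (\<lambda>x. x @ [False]) ` visited P \<union> (\<lambda>x. x @ [True]) ` f ` visited P
    \<longleftrightarrow> y \<in> layer (2 * n + 1) n \<union> layer (2 * n + 1) (n + 1)"
  proof (cases y rule: rev_cases)
    case Nil
    then show ?thesis using n_pos by (auto simp: layer_def)
  next
    case (snoc x b)
    then show ?thesis
      unfolding f_visited unfolding visited_P using n_pos
      by (cases b) (auto simp: layer_def image_iff)
  qed
qed

lemma edges_C: "edges (C_graph a P) = uedges directed"
proof -
  have "M_FL P = uedges ((\<lambda>v. (v @ [False], v @ [True])) ` dipping (2 * n) n)
      \<union> uedges ((\<lambda>v. (v @ [True], v @ [False])) ` touching (2 * n) n)"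
    unfolding M_FL_def first_P last_P uedges_eq_image by (auto simp: image_iff insert_commute)
  moreover have "edges (family_graph Q) = uedges (\<Union>p\<in>Q. arcs_path p)" for Q :: "bits opath set"
    by (simp add: family_graph_def edges_path_graph uedges_UN)
  ultimately show ?thesis
    unfolding C_graph_def graph_union_def graph_of_edges_def directed_def uedges_Un
      arcs_P_def arcs_fP_def uedges_image uedges_converse graph.simps
    by (simp only: append_family(6)[OF disjoint_P] append_family(6)[OF disjoint_f] uedges_image Un_assoc)
qed

lemma two_factor_C: "two_factor (C_graph a P) (cube_layers (2 * n + 1) n)"
proof -
  have "edges (C_graph a P) \<subseteq> edges (cube_layers (2 * n + 1) n)"
  proof
    fix e assume "e \<in> edges (C_graph a P)"
    then obtain u v where uv: "(u, v) \<in> directed" "e = {u, v}"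
      unfolding edges_C by (rule uedgesE)
    have "u \<in> verts (C_graph a P)" using uv verts_C_directed(1) by blast
    moreover have "v \<in> verts (C_graph a P)" using uv verts_C_directed(2) by blast
    moreover have "hamming u v = 1" using uv steps_directed by (auto simp: unit_steps_def)
    ultimately show "e \<in> edges (cube_layers (2 * n + 1) n)"
      unfolding uv(2) verts_C by (rule cube_layers_edgeI)
  qed
  moreover have "degree (C_graph a P) v = 2" if "v \<in> verts (C_graph a P)" for v
    using that verts_C_directed
    by (intro degree_uedges[OF edges_C single_valued_directed directed_antisym]) auto
  ultimately show ?thesis
    using verts_C by (simp add: two_factor_def subgraph_def verts_cube_layers)
qed

lemma first_arc: "p \<in> P \<Longrightarrow> (first_v p @ [False], second_v p @ [False]) \<in> directed"
  using path_vertices(4) disjoint_pathsD[OF disjoint_P] directed_snoc(1) unfolding arcs_P_def by blast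

text \<open>A cycle runs wholly along or wholly against \<open>directed\<close>, and every edge from
  F(P) to S(P) is an arc of \<open>directed\<close>; in the second case the reversed traversal
  serves.\<close>

lemma same_orientation_C:
  assumes "cycle_in (C_graph a P) c"
  shows "same_orientation P c"
proof -
  have "(u, v) \<in> directed \<or> (v, u) \<in> directed" if "(u, v) \<in> arcs_cycle c" for u v
    using that assms uedges_pair_iff[of u v directed]
    unfolding cycle_in_def edges_C cycle_edges_def by blast
  then consider "arcs_cycle c \<subseteq> directed" | "arcs_cycle c \<subseteq> directed\<inverse>"
    using cycle_orientation[OF single_valued_directed, of c] assms unfolding cycle_in_def by blast
  then show ?thesis
  proof cases
    case 1
    have "(first_v p @ [False], second_v p @ [False]) \<in> arcs_cycle c"
      if "p \<in> P" "{first_v p @ [False], second_v p @ [False]} \<in> cycle_edges c" for p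
      using that 1 first_arc[OF that(1)] directed_antisym
      unfolding cycle_edges_def uedges_def[symmetric] uedges_pair_iff by blast
    then show ?thesis unfolding same_orientation_def by blast
  next
    case 2
    have "(second_v p @ [False], first_v p @ [False]) \<in> arcs_cycle c"
      if "p \<in> P" "{first_v p @ [False], second_v p @ [False]} \<in> cycle_edges c" for p
      using that 2 first_arc[OF that(1)] directed_antisym
      unfolding cycle_edges_def uedges_def[symmetric] uedges_pair_iff by blast
    then have "(first_v p @ [False], second_v p @ [False]) \<in> arcs_cycle (rev c)"
      if "p \<in> P" "{first_v p @ [False], second_v p @ [False]} \<in> cycle_edges c" for p
      using that by (intro arcs_cycle_rev)
    then show ?thesis unfolding same_orientation_def by blast
  qed
qed

section \<open>The components of the joined graph as explicit paths\<close>

text \<open>The path of the 2-factor that leaves \<open>p\<close> at its last vertex enters \<open>f(partner p)\<close>.\<close>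

definition partner :: "bits opath \<Rightarrow> bits opath" where
  "partner p = inv_into P (f \<circ> last_v) (last_v p)"

text \<open>Last vertices put \<open>P\<close> in bijection with \<open>dipping (2 * n) n\<close>,
  and \<open>f\<close> permutes that set.\<close>

lemma bij_partner: "bij_betw partner P P"
proof -
  have last: "bij_betw last_v P (dipping (2 * n) n)"
    using inj_on_endpoints(2)[OF disjoint_P] last_P by (simp add: bij_betw_def)
  have "bij_betw f (dipping (2 * n) n) (dipping (2 * n) n)"
    using f_map_dipping[OF length_a] inj_on_subset[OF inj_f endpoints_subset(2)] by (simp add: bij_betw_def)
  then have "bij_betw (f \<circ> last_v) P (dipping (2 * n) n)"
    by (rule bij_betw_trans[OF last])
  then have "bij_betw (inv_into P (f \<circ> last_v) \<circ> last_v) P P"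
    by (rule bij_betw_trans[OF last bij_betw_inv_into])
  moreover have "partner = inv_into P (f \<circ> last_v) \<circ> last_v"
    by (auto simp: partner_def)
  ultimately show ?thesis by simp
qed

lemma partner_in: "p \<in> P \<Longrightarrow> partner p \<in> P"
  using bij_partner by (auto simp: bij_betw_def)

lemma last_partner:
  assumes "p \<in> P"
  shows "f (last_v (partner p)) = last_v p"
proof -
  have "last_v p \<in> (f \<circ> last_v) ` P"
    using assms last_P f_map_dipping[OF length_a] by (auto simp flip: image_image)
  then show ?thesis
    unfolding partner_def using f_inv_into_f[of "last_v p" "f \<circ> last_v" P] by simp
qed

text \<open>Enter at the second vertex of \<open>p\<close>, follow \<open>p\<close> to its end,
  cross to the other copy, run back along the image of the partner and cross over again. The vertex
  reached is the first vertex of some path in \<open>P\<close>, whose edge to its second vertex has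
  been deleted, so the component ends there.\<close>

definition joined_path :: "bits opath \<Rightarrow> bits opath" where
  "joined_path p = (second_v p @ [False, False]) # map (\<lambda>x. x @ [False, True]) (tl p)
    @ map (\<lambda>x. x @ [True, True]) (rev (map f (partner p)))
    @ [f (first_v (partner p)) @ [False, True]]"

lemma path_facts:
  assumes "p \<in> P"
  shows "distinct p" "p \<noteq> []" "tl p \<noteq> []" "hd (tl p) = second_v p" "last (tl p) = last_v p"
    "set p \<subseteq> visited P" "set p = insert (first_v p) (set (tl p))" "first_v p \<notin> set (tl p)"
    "arcs_path p = insert (first_v p, second_v p) (arcs_path (tl p))"
proof -
  obtain x y r where "p = x # y # r"
    using disjoint_pathsD[OF disjoint_P assms]
    by (metis is_opath_def One_nat_def Suc_1 Suc_le_length_iff)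
  moreover have "is_opath p"
    using disjoint_pathsD[OF disjoint_P assms] .
  moreover show "set p \<subseteq> visited P"
    using assms by (auto simp: visited_def)
  ultimately show "distinct p" "p \<noteq> []" "tl p \<noteq> []" "hd (tl p) = second_v p" "last (tl p) = last_v p"
    "set p = insert (first_v p) (set (tl p))" "first_v p \<notin> set (tl p)"
    "arcs_path p = insert (first_v p, second_v p) (arcs_path (tl p))"
    by (auto simp: is_opath_def first_v_def second_v_def last_v_def)
qed

text \<open>A first vertex occurs on its own path only, and there in front. Needed because the final
  vertex of \<open>joined_path p\<close> carries the same suffix 01 as the vertices from
  \<open>tl p\<close>.\<close>

lemma touching_notin_tl:
  assumes "p \<in> P" "x \<in> touching (2 * n) n"
  shows "x \<notin> set (tl p)"
proof
  assume x: "x \<in> set (tl p)"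
  obtain q where q: "q \<in> P" "x = first_v q" using assms(2) first_P by auto
  have "p = q"
    using disjoint_paths_eq[OF disjoint_P assms(1) q(1), of x] x path_facts(7)[OF assms(1)]
      path_facts(7)[OF q(1)] q(2) by auto
  then show False using x q path_facts(8) by auto
qed

lemma f_first_partner: "p \<in> P \<Longrightarrow> f (first_v (partner p)) \<in> touching (2 * n) n"
  using first_P f_map_touching[OF length_a] partner_in by blast

lemma joined_path_ends:
  assumes "p \<in> P"
  shows "first_v (joined_path p) = second_v p @ [False, False]"
    "second_v (joined_path p) = second_v p @ [False, True]"
    "last_v (joined_path p) = f (first_v (partner p)) @ [False, True]"
  using path_facts(3,4)[OF assms]
  by (cases "tl p"; simp add: joined_path_def first_v_def last_v_def second_v_def)+

lemma set_joined_path: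
  "set (joined_path p) = {second_v p @ [False, False]}
    \<union> (\<lambda>x. x @ [False, True]) ` set (tl p)
    \<union> (\<lambda>x. x @ [True, True]) ` f ` set (partner p)
    \<union> {f (first_v (partner p)) @ [False, True]}"
  by (auto simp: joined_path_def)

lemma is_opath_joined_path:
  assumes "p \<in> P"
  shows "is_opath (joined_path p)"
proof -
  note p = path_facts[OF assms] and q = path_facts[OF partner_in[OF assms]]
  have "distinct (tl p)" using p(1) by (rule distinct_tl)
  moreover have "distinct (map f (partner p))"
    using q(1,6) inj_f by (auto simp: distinct_map intro: inj_on_subset)
  moreover have "f (first_v (partner p)) \<notin> set (tl p)"
    using touching_notin_tl[OF assms f_first_partner[OF assms]] .
  ultimately show ?thesis
    unfolding is_opath_def joined_path_def by (auto simp: distinct_map inj_on_def)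
qed

text \<open>The suffixes leave few ways to share a vertex. In each, disjointness of \<open>P\<close>
  or injectivity of \<open>second_v\<close>, \<open>f\<close> or \<open>partner\<close> gives
  \<open>p = q\<close>, and a tail meets no final vertex by
  \<open>touching_notin_tl\<close>.\<close>

lemma disjoint_joined_paths: "disjoint_paths (joined_path ` P)"
proof -
  have "p = q" if pq: "p \<in> P" "q \<in> P" and y: "y \<in> set (joined_path p)" "y \<in> set (joined_path q)" for p q y
  proof -
    note sub = path_facts(6)[OF partner_in[OF pq(1)]] path_facts(6)[OF partner_in[OF pq(2)]]
    have tl: "x \<in> set (tl p) \<Longrightarrow> x \<in> set (tl q) \<Longrightarrow> p = q" for x
      using disjoint_paths_eq[OF disjoint_P pq] path_facts(7)[OF pq(1)] path_facts(7)[OF pq(2)] by auto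
    have partner: "p = q" if "x \<in> set (partner p)" "x' \<in> set (partner q)" "f x = f x'" for x x'
    proof -
      have "x = x'" using that sub inj_f by (auto simp: inj_on_def)
      then have "partner p = partner q"
        using disjoint_paths_eq[OF disjoint_P partner_in[OF pq(1)] partner_in[OF pq(2)]] that by auto
      then show ?thesis using bij_partner pq by (auto simp: bij_betw_def inj_on_def)
    qed
    have second: "second_v p = second_v q \<Longrightarrow> p = q"
      using inj_on_endpoints(3)[OF disjoint_P] pq by (auto simp: inj_on_def)
    have first: "f (first_v (partner p)) = f (first_v (partner q)) \<Longrightarrow> p = q"
      using partner[of "first_v (partner p)" "first_v (partner q)"]
        path_facts(7)[OF partner_in[OF pq(1)]] path_facts(7)[OF partner_in[OF pq(2)]] by auto
    note no = touching_notin_tl[OF pq(1) f_first_partner[OF pq(2)]] touching_notin_tl[OF pq(2) f_first_partner[OF pq(1)]]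
    show ?thesis
      using y no tl partner second first unfolding set_joined_path by (auto simp del: set_map)
  qed
  then have "pairwise (\<lambda>p q. set p \<inter> set q = {}) (joined_path ` P)"
    by (fastforce simp: pairwise_def)
  then show ?thesis
    using is_opath_joined_path by (auto simp: disjoint_paths_def)
qed

lemma partner_image: "partner ` P = P"
  using bij_partner by (simp add: bij_betw_def)

lemma visited_joined:
  "visited (joined_path ` P) = (\<lambda>x. x @ [False, False]) ` positive (2 * n) (Suc n)
    \<union> (\<lambda>x. x @ [False, True]) ` visited P \<union> (\<lambda>x. x @ [True, True]) ` f ` visited P"
proof -
  have "(\<Union>p\<in>P. g (partner p)) = (\<Union>p\<in>P. g p)" for g :: "bits opath \<Rightarrow> bits set"
    using partner_image by (metis image_image)
  from this[of "\<lambda>p. (\<lambda>x. x @ [True, True]) ` f ` set p"] this[of "\<lambda>p. {f (first_v p) @ [False, True]}"]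
  have "visited (joined_path ` P) = (\<Union>p\<in>P. {second_v p @ [False, False]})
      \<union> ((\<Union>p\<in>P. (\<lambda>x. x @ [False, True]) ` set (tl p))
        \<union> (\<Union>p\<in>P. {f (first_v p) @ [False, True]}))
      \<union> (\<Union>p\<in>P. (\<lambda>x. x @ [True, True]) ` f ` set p)"
    unfolding visited_def by (simp only: UN_simps set_joined_path UN_Un_distrib Un_ac)
  moreover have "(\<Union>p\<in>P. {f (first_v p) @ [False, True]}) = (\<lambda>x. x @ [False, True]) ` touching (2 * n) n"
    using f_map_touching[OF length_a] unfolding first_P[symmetric] by (auto simp: image_iff)
  \<comment> \<open>The first vertices cut off by \<open>tl\<close> come back as final vertices of
    joined paths.\<close>
  moreover have "(\<Union>p\<in>P. (\<lambda>x. x @ [False, True]) ` set (tl p)) \<union> (\<lambda>x. x @ [False, True]) ` touching (2 * n) n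
      = (\<lambda>x. x @ [False, True]) ` visited P"
    unfolding first_P[symmetric] visited_def using path_facts(7) by auto
  moreover have "(\<Union>p\<in>P. {second_v p @ [False, False]}) = (\<lambda>x. x @ [False, False]) ` positive (2 * n) (Suc n)"
    unfolding second_P[symmetric] by auto
  moreover have "(\<Union>p\<in>P. (\<lambda>x. x @ [True, True]) ` f ` set p) = (\<lambda>x. x @ [True, True]) ` f ` visited P"
    unfolding visited_def by auto
  ultimately show ?thesis
    by (simp only:)
qed

lemma arcs_joined_path:
  assumes "p \<in> P"
  shows "arcs_path (joined_path p) = {(second_v p @ [False, False], second_v p @ [False, True])}
    \<union> map_prod (\<lambda>x. x @ [False, True]) (\<lambda>x. x @ [False, True]) ` arcs_path (tl p)
    \<union> {(last_v p @ [False, True], last_v p @ [True, True])}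
    \<union> map_prod (\<lambda>x. x @ [True, True]) (\<lambda>x. x @ [True, True]) ` (arcs_path (map f (partner p)))\<inverse>
    \<union> {(f (first_v (partner p)) @ [True, True], f (first_v (partner p)) @ [False, True])}"
proof -
  note p = path_facts[OF assms] and q = path_facts[OF partner_in[OF assms]]
  define R where "R = rev (map f (partner p))"
  \<comment> \<open>By \<open>last_partner\<close> the head of \<open>R\<close> is
    \<open>last_v p\<close>, so the crossing is a matching edge.\<close>
  have R: "hd R = last_v p" "last R = f (first_v (partner p))" "R \<noteq> []"
    "arcs_path R = (arcs_path (map f (partner p)))\<inverse>"
    using q(2) last_partner[OF assms]
    by (auto simp: R_def hd_rev last_rev last_map hd_map last_v_def first_v_def arcs_path_rev)
  show ?thesis
    unfolding joined_path_def R_def[symmetric] R(4)[symmetric] using p(3-5) R(1-3)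
    by (auto simp: arcs_path_Cons' arcs_path_append arcs_path_map hd_map last_map)
qed

definition remaining :: "(bits \<times> bits) set" where
  "remaining = directed - (\<lambda>p. (first_v p @ [False], second_v p @ [False])) ` P"

lemma arcs_joined:
  "(\<Union>p\<in>joined_path ` P. arcs_path p) = (\<lambda>s. (s @ [False, False], s @ [False, True])) ` positive (2 * n) (Suc n)
    \<union> map_prod (\<lambda>x. x @ [True]) (\<lambda>x. x @ [True]) ` remaining"
proof -
  let ?app = "\<lambda>z x :: bits. x @ z"
  have partner: "(\<Union>p\<in>P. g (partner p)) = (\<Union>p\<in>P. g p)" for g :: "bits opath \<Rightarrow> (bits \<times> bits) set"
    using partner_image by (metis image_image)
  have "(\<Union>p\<in>joined_path ` P. arcs_path p) = (\<Union>p\<in>P. {(second_v p @ [False, False], second_v p @ [False, True])})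
      \<union> (\<Union>p\<in>P. map_prod (?app [False, True]) (?app [False, True]) ` arcs_path (tl p))
      \<union> (\<Union>p\<in>P. {(last_v p @ [False, True], last_v p @ [True, True])})
      \<union> (\<Union>p\<in>P. map_prod (?app [True, True]) (?app [True, True]) ` (arcs_path (map f p))\<inverse>)
      \<union> (\<Union>p\<in>P. {(f (first_v p) @ [True, True], f (first_v p) @ [False, True])})"
    (is "_ = ?A \<union> ?B \<union> ?C \<union> ?D \<union> ?E")
  proof -
    have "(\<Union>p\<in>joined_path ` P. arcs_path p) = (\<Union>p\<in>P.
        {(second_v p @ [False, False], second_v p @ [False, True])}
      \<union> map_prod (?app [False, True]) (?app [False, True]) ` arcs_path (tl p)
      \<union> {(last_v p @ [False, True], last_v p @ [True, True])}
      \<union> map_prod (?app [True, True]) (?app [True, True]) ` (arcs_path (map f (partner p)))\<inverse>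
      \<union> {(f (first_v (partner p)) @ [True, True], f (first_v (partner p)) @ [False, True])})"
      unfolding UN_simps(10) by (intro SUP_cong refl arcs_joined_path)
    also have "\<dots> = ?A \<union> ?B \<union> ?C \<union> ?D \<union> ?E"
      unfolding UN_Un_distrib
      using partner[of "\<lambda>p. map_prod (?app [True, True]) (?app [True, True]) ` (arcs_path (map f p))\<inverse>"]
        partner[of "\<lambda>p. {(f (first_v p) @ [True, True], f (first_v p) @ [False, True])}"]
      by simp
    finally show ?thesis .
  qed
  moreover have "?A = (\<lambda>s. (s @ [False, False], s @ [False, True])) ` positive (2 * n) (Suc n)"
    unfolding second_P[symmetric] by auto
  moreover have "?C = (\<lambda>s. (s @ [False, True], s @ [True, True])) ` dipping (2 * n) n"
    unfolding last_P[symmetric] by auto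
  moreover have "?E = (\<lambda>s. (s @ [True, True], s @ [False, True])) ` touching (2 * n) n"
    by (subst f_map_touching[OF length_a, symmetric], subst first_P[symmetric]) auto
  moreover have "?D = map_prod (?app [True, True]) (?app [True, True]) ` arcs_fP\<inverse>"
    unfolding arcs_fP_def by (auto simp: converse_UNION image_UN)
  \<comment> \<open>In \<open>arcs_P\<close> only the arc to the second vertex leaves a first
    vertex, so removing these arcs leaves exactly the arcs of the tails.\<close>
  moreover have "?B = map_prod (?app [False, True]) (?app [False, True]) ` (arcs_P - (\<lambda>p. (first_v p, second_v p)) ` P)"
  proof -
    have "(first_v p, y) \<notin> arcs_path (tl q)" if "p \<in> P" "q \<in> P" for p q y
      using touching_notin_tl[OF that(2), of "first_v p"] that(1) first_P arcs_path_subset[of "tl q"] by auto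
    then have "arcs_P - (\<lambda>p. (first_v p, second_v p)) ` P = (\<Union>p\<in>P. arcs_path (tl p))"
      unfolding arcs_P_def using path_facts(9) by auto
    then show ?thesis by (simp add: image_UN)
  qed
  moreover have "remaining = map_prod (?app [False]) (?app [False]) ` (arcs_P - (\<lambda>p. (first_v p, second_v p)) ` P)
      \<union> map_prod (?app [True]) (?app [True]) ` arcs_fP\<inverse>
      \<union> (\<lambda>v. (v @ [False], v @ [True])) ` dipping (2 * n) n
      \<union> (\<lambda>v. (v @ [True], v @ [False])) ` touching (2 * n) n"
    unfolding remaining_def directed_def by (auto simp del: UN_simps UN_iff simp: image_iff)
  ultimately show ?thesis
    by (simp add: image_Un image_image map_prod_def case_prod_beta Un_assoc Un_commute Un_left_commute)
qed

text \<open>Reduces the question of components to \<open>components_family_graph\<close>, as the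
  right-hand side comes from a disjoint family.\<close>

lemma joined_graph_eq: "joined_graph a P = family_graph (joined_path ` P)"
proof -
  let ?S = "(\<lambda>s. (s @ [False, False], s @ [False, True])) ` positive (2 * n) (Suc n)"
  have M: "M_S P = uedges ?S"
    unfolding M_S_def second_P uedges_eq_image by auto
  have sp: "{{first_v p @ [False], second_v p @ [False]} | p. p \<in> P}
      = uedges ((\<lambda>p. (first_v p @ [False], second_v p @ [False])) ` P)"
    unfolding uedges_eq_image by auto
  have "edges (C_minus a P) = uedges remaining"
    unfolding C_minus_def delete_edges_def graph.simps edges_C sp remaining_def
    using directed_antisym first_arc by (intro uedges_diff) auto
  then have "edges (joined_graph a P) = uedges (\<Union>p\<in>joined_path ` P. arcs_path p)"
    unfolding arcs_joined by (simp add: joined_graph_def graph_union_def graph_of_edges_def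
        append_graph_def map_graph_def M uedges_Un uedges_image)
  moreover have "verts (joined_graph a P) = visited (joined_path ` P)"
  proof -
    have "verts (C_minus a P) = (\<lambda>x. x @ [False]) ` visited P \<union> (\<lambda>x. x @ [True]) ` f ` visited P"
      unfolding C_minus_def delete_edges_def using verts_C_directed directed_Domain_Range by simp
    then have "verts (joined_graph a P) = \<Union> (M_S P)
        \<union> (\<lambda>x. x @ [False, True]) ` visited P \<union> (\<lambda>x. x @ [True, True]) ` f ` visited P"
      by (simp add: joined_graph_def graph_union_def graph_of_edges_def append_graph_def map_graph_def
          image_Un image_image Un_assoc)
    moreover have "\<Union> (M_S P) = (\<lambda>x. x @ [False, False]) ` positive (2 * n) (Suc n)
        \<union> (\<lambda>x. x @ [False, True]) ` positive (2 * n) (Suc n)"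
      unfolding M_S_def second_P by auto
    moreover have "positive (2 * n) (Suc n) \<subseteq> visited P"
      unfolding visited_P by (auto simp: positive_def)
    ultimately show ?thesis unfolding visited_joined by auto
  qed
  moreover have "edges (family_graph (joined_path ` P)) = uedges (\<Union>p\<in>joined_path ` P. arcs_path p)"
    by (simp add: family_graph_def edges_path_graph uedges_UN)
  moreover have "verts (family_graph (joined_path ` P)) = visited (joined_path ` P)"
    by (simp add: family_graph_def)
  ultimately show ?thesis
    by (intro graph.equality) auto
qed

text \<open>Only the front vertex of \<open>joined_path p\<close> has suffix 00. Hence it contains
  one edge of \<open>M_S P\<close>, every admissible orientation starts there, and
  \<open>arcs_path_inj\<close> makes it unique.\<close>

lemma orients_joined_path:
  assumes "p \<in> P"
  shows "orients P (path_graph (joined_path p)) q \<longleftrightarrow> q = joined_path p"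
proof
  note ends = joined_path_ends[OF assms]
  have start: "s = second_v p" if "s @ [False, False] \<in> set (joined_path p)" for s
    using that unfolding set_joined_path by auto
  {
    assume "orients P (path_graph (joined_path p)) q"
    then have q: "is_opath q" "path_graph q = path_graph (joined_path p)"
      "\<exists>s. first_v q = s @ [False, False]"
      unfolding orients_def by auto
    then have "set q = set (joined_path p)" "uedges (arcs_path q) = uedges (arcs_path (joined_path p))"
      by (metis verts_path_graph, metis edges_path_graph)
    moreover from this have "first_v q = first_v (joined_path p)"
      using q path_vertices(1) start unfolding ends by metis
    ultimately show "q = joined_path p"
      using q(1) is_opath_joined_path[OF assms]
      by (intro arcs_path_inj[of q "joined_path p"]) (auto simp: is_opath_def first_v_def)
  }
  have "e \<in> M_S P \<Longrightarrow> e \<in> edges (path_graph (joined_path p))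
      \<Longrightarrow> e = {second_v p @ [False, False], second_v p @ [False, True]}" for e
  proof -
    assume "e \<in> M_S P" "e \<in> edges (path_graph (joined_path p))"
    then obtain s where s: "e = {s @ [False, False], s @ [False, True]}"
      and e: "e \<in> uedges (arcs_path (joined_path p))"
      unfolding M_S_def edges_path_graph by blast
    have "e \<subseteq> set (joined_path p)"
      using e arcs_path_subset[of "joined_path p"] by (auto elim!: uedgesE)
    then show "e = {second_v p @ [False, False], second_v p @ [False, True]}"
      using s start by auto
  qed
  moreover have "{second_v p @ [False, False], second_v p @ [False, True]} \<in> edges (path_graph (joined_path p))"
    unfolding edges_path_graph uedges_pair_iff arcs_joined_path[OF assms] by simp
  moreover have "{second_v p @ [False, False], second_v p @ [False, True]} \<in> M_S P"
    unfolding M_S_def using assms by blast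
  ultimately have "edges (path_graph (joined_path p)) \<inter> M_S P
      = {{first_v (joined_path p), second_v (joined_path p)}}"
    unfolding ends by blast
  then show "q = joined_path p \<Longrightarrow> orients P (path_graph (joined_path p)) q"
    unfolding orients_def using is_opath_joined_path[OF assms] ends assms by auto
qed

lemma components_joined: "components (joined_graph a P) = path_graph ` joined_path ` P"
  unfolding joined_graph_eq by (rule components_family_graph[OF disjoint_joined_paths])

lemma P_prime_eq: "P_prime a P = joined_path ` P"
  unfolding P_prime_def components_joined using orients_joined_path by auto

lemma step_possible: "step_possible a P"
  unfolding step_possible_def components_joined
  using orients_joined_path disjoint_pathsD[OF disjoint_P] by auto

lemma cube_family_step:
  assumes "cube_family (2 * n) (Suc n) A"
  shows "cube_family (2 * Suc n) (Suc n)
    (append_family A [False, False] \<union> append_family P [True, False] \<union> P_prime a P)"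
  unfolding P_prime_eq
proof (rule cube_family_step_middle[OF n_pos assms family disjoint_joined_paths])
  have "unit_steps (map_prod (\<lambda>x. x @ [True]) (\<lambda>x. x @ [True]) ` remaining)"
    using steps_directed by (intro unit_steps_append) (auto simp: unit_steps_def remaining_def)
  then show "unit_steps (\<Union>p\<in>joined_path ` P. arcs_path p)"
    unfolding arcs_joined unit_steps_Un using hamming_append[of "_ @ [False]"] hamming_bit[of False True "_ @ [False]" "[]"]
    by (auto simp: unit_steps_def)
  show "visited (joined_path ` P) = (\<lambda>x. x @ [False, False]) ` positive (2 * n) (Suc n)
      \<union> (\<lambda>x. x @ [False, True]) ` (layer (2 * n) (Suc n) \<union> layer (2 * n) n)
      \<union> (\<lambda>x. x @ [True, True]) ` (layer (2 * n) n \<union> layer (2 * n) (n - 1))"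
    unfolding visited_joined visited_P f_visited[unfolded visited_P] ..
  show "first_v ` joined_path ` P = (\<lambda>x. x @ [False, False]) ` positive (2 * n) (Suc n)"
    unfolding second_P[symmetric] image_image by (simp add: joined_path_ends)
  show "second_v ` joined_path ` P = (\<lambda>x. x @ [False, True]) ` positive (2 * n) (Suc n)"
    unfolding second_P[symmetric] image_image by (simp add: joined_path_ends)
  \<comment> \<open>\<open>partner\<close> permutes \<open>P\<close> and \<open>f\<close> permutes
    the first vertices, so the final vertices run through all old first vertices with suffix
    01.\<close>
  have "last_v ` joined_path ` P = (\<lambda>x. x @ [False, True]) ` f ` first_v ` partner ` P"
    unfolding image_image by (simp add: joined_path_ends)
  then show "last_v ` joined_path ` P = (\<lambda>x. x @ [False, True]) ` touching (2 * n) n"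
    by (simp only: partner_image first_P f_map_touching[OF length_a])
qed

end


text \<open>The parameters below \<open>n\<close> are the ones that
  \<open>P_family \<alpha> n\<close> uses. All levels \<open>k \<ge> n\<close> are included because
  the step also draws on levels where the family is empty.\<close>

lemma P_family_invariant:
  assumes "1 \<le> n" "\<forall>i\<in>{1..<n}. length (\<alpha> (2 * i)) = i - 1"
  shows "(\<forall>k\<ge>n. cube_family (2 * n) k (P_family \<alpha> n k))
    \<and> (\<forall>m\<in>{1..<n}. step_possible (\<alpha> (2 * m)) (P_family \<alpha> m m))"
  using assms
proof (induction n rule: dec_induct)
  case base
  have "cube_family (2 * 1) k (P_family \<alpha> 1 k)" if "1 \<le> k" for k
    using that cube_family_base cube_family_empty[of 2 k] by (cases "k = 1") auto
  then show ?case by simp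
next
  case (step n)
  then have inv: "\<And>k. n \<le> k \<Longrightarrow> cube_family (2 * n) k (P_family \<alpha> n k)"
    and poss: "\<forall>m\<in>{1..<n}. step_possible (\<alpha> (2 * m)) (P_family \<alpha> m m)"
    by auto
  interpret middle_family n "\<alpha> (2 * n)" "P_family \<alpha> n n"
    using inv[of n] step by unfold_locales auto
  have "cube_family (2 * Suc n) k (P_family \<alpha> (Suc n) k)" if k: "Suc n \<le> k" for k
  proof -
    \<comment> \<open>The branches of the recursion: the level with joined paths, the levels with
      four suffixes, and the empty levels.\<close>
    consider (1) "k = Suc n" | (2) j where "k = Suc (Suc j)" "n \<le> j" "k \<le> 2 * n + 1" | (3) "2 * Suc n \<le> k"
    proof (cases "k = Suc n \<or> 2 * Suc n \<le> k")
      case False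
      then have "k = Suc (Suc (k - 2))" "n \<le> k - 2" "k \<le> 2 * n + 1" using k by auto
      then show thesis by (rule 2)
    qed blast
    then show ?thesis
    proof cases
      case 1
      then show ?thesis
        using cube_family_step[OF inv[of "Suc n"]] n_pos by simp
    next
      case (2 j)
      then show ?thesis
        using cube_family_step_high[OF n_pos 2(2) inv inv inv] n_pos by simp
    next
      case 3
      then show ?thesis
        using cube_family_empty[of "2 * Suc n" k] n_pos by simp
    qed
  qed
  moreover have "\<forall>m\<in>{1..<Suc n}. step_possible (\<alpha> (2 * m)) (P_family \<alpha> m m)"
    using poss step_possible by (auto simp: less_Suc_eq)
  ultimately show ?case by blast
qed

theorem mainTheorem1:
  fixes n :: nat and \<alpha> :: "nat \<Rightarrow> bits"
  assumes "n \<ge> 1"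
    and "\<forall>i\<in>{1..n}. length (\<alpha> (2 * i)) = i - 1"
  shows "construction_possible \<alpha> n
    \<and> (\<forall>k\<in>{n..2 * n - 1}.
        (\<forall>p\<in>P_family \<alpha> n k.
          opath_in (cube_layers (2 * n) k) p
          \<and> first_v p \<in> layer (2 * n) k \<and> last_v p \<in> layer (2 * n) k)
        \<and> pairwise (\<lambda>p q. set p \<inter> set q = {}) (P_family \<alpha> n k))
    \<and> layer (2 * n) (n + 1) \<union> layer (2 * n) n \<subseteq> visited (P_family \<alpha> n n)
    \<and> (\<forall>k\<in>{n + 1..2 * n - 1}.
        layer (2 * n) (k + 1) \<subseteq> visited (P_family \<alpha> n k)
        \<and> layer (2 * n) k - visited (P_family \<alpha> n k) = second_v ` P_family \<alpha> n (k - 1))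
    \<and> two_factor (C_cycles \<alpha> n) (cube_layers (2 * n + 1) n)
    \<and> (\<forall>c. cycle_in (C_cycles \<alpha> n) c \<longrightarrow> same_orientation (P_family \<alpha> n n) c)"
proof -
  have inv: "cube_family (2 * n) k (P_family \<alpha> n k)" if "n \<le> k" for k
    using P_family_invariant[of n \<alpha>] assms that by simp
  have "construction_possible \<alpha> n"
    using P_family_invariant[of n \<alpha>] assms by (simp add: construction_possible_def)
  moreover have "\<forall>k\<in>{n..2 * n - 1}.
      (\<forall>p\<in>P_family \<alpha> n k.
        opath_in (cube_layers (2 * n) k) p
        \<and> first_v p \<in> layer (2 * n) k \<and> last_v p \<in> layer (2 * n) k)
      \<and> pairwise (\<lambda>p q. set p \<inter> set q = {}) (P_family \<alpha> n k)"
  proof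
    fix k assume "k \<in> {n..2 * n - 1}"
    then have k: "cube_family (2 * n) k (P_family \<alpha> n k)" using inv by simp
    have "first_v p \<in> layer (2 * n) k \<and> last_v p \<in> layer (2 * n) k" if "p \<in> P_family \<alpha> n k" for p
    proof -
      have "first_v p \<in> touching (2 * n) k" "last_v p \<in> dipping (2 * n) k"
        using k that unfolding cube_family_def by blast+
      then show ?thesis by (simp add: touching_def dipping_def)
    qed
    then show "(\<forall>p\<in>P_family \<alpha> n k.
        opath_in (cube_layers (2 * n) k) p
        \<and> first_v p \<in> layer (2 * n) k \<and> last_v p \<in> layer (2 * n) k)
      \<and> pairwise (\<lambda>p q. set p \<inter> set q = {}) (P_family \<alpha> n k)"
      using k cube_family_opath_in[OF k] by (auto simp: cube_family_def disjoint_paths_def)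
  qed
  moreover have "layer (2 * n) (n + 1) \<union> layer (2 * n) n \<subseteq> visited (P_family \<alpha> n n)"
    using inv[of n] positive_middle[OF assms(1)] by (simp add: cube_family_def)
  moreover have "\<forall>k\<in>{n + 1..2 * n - 1}.
      layer (2 * n) (k + 1) \<subseteq> visited (P_family \<alpha> n k)
      \<and> layer (2 * n) k - visited (P_family \<alpha> n k) = second_v ` P_family \<alpha> n (k - 1)"
  proof
    fix k assume "k \<in> {n + 1..2 * n - 1}"
    \<comment> \<open>The second vertices for \<open>k - 1\<close> are the positive paths at level
      \<open>Suc (k - 1)\<close>, which are the vertices left out at level \<open>k\<close>.\<close>
    then have "Suc (k - 1) = k" "n \<le> k - 1" "n \<le> k" by auto
    then have "visited (P_family \<alpha> n k)
        = layer (2 * n) (Suc k) \<union> (layer (2 * n) k - positive (2 * n) k)"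
      "second_v ` P_family \<alpha> n (k - 1) = positive (2 * n) k"
      using inv[of k] inv[of "k - 1"] unfolding cube_family_def by metis+
    then show "layer (2 * n) (k + 1) \<subseteq> visited (P_family \<alpha> n k)
      \<and> layer (2 * n) k - visited (P_family \<alpha> n k) = second_v ` P_family \<alpha> n (k - 1)"
      by (auto simp: layer_def positive_def)
  qed
  \<comment> \<open>The parameter for \<open>n\<close> itself enters here, since
    \<open>C_cycles \<alpha> n\<close> applies \<open>f_map\<close> with it.\<close>
  moreover interpret middle_family n "\<alpha> (2 * n)" "P_family \<alpha> n n"
    using inv[of n] assms by unfold_locales auto
  have "two_factor (C_cycles \<alpha> n) (cube_layers (2 * n + 1) n)"
    "\<forall>c. cycle_in (C_cycles \<alpha> n) c \<longrightarrow> same_orientation (P_family \<alpha> n n) c"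
    using two_factor_C same_orientation_C by (simp_all add: C_cycles_def)
  ultimately show ?thesis by blast
qed

end
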